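(* There is a randomized online algorithm for supermodular paging that is $O\!\left(\log^2\mu\cdot\log\!\left(\frac{c_{\max}}{c_{\min}}\cdot f(\mathcal{P})\right)\right)$-competitive, where $c_{\max}$ and $c_{\min}$ are the maximum and minimum page costs and $\mu=\max\{|S| : S\subseteq\mathcal{P},\ f(S)\le k\}$.
   Context: Supermodular paging is non-linear paging with a supermodular feasibility function. Non-linear paging: a finite set $\mathcal{P}$ of pages, each page $p$ with eviction cost $c(p)>0$; a monotone feasibility function $f:2^{\mathcal{P}}\to\mathbb{N}$ ($S'\subseteq S\Rightarrow f(S')\le f(S)$); a cache threshold $k$ with $f(\{p\})\le k$ for every page $p$. The cache is initially empty; requests $p_t\in\mathcal{P}$ arrive online at times $t=1,2,\dots$; at time $t$, if $p_t$ is not in the cache it is fetched, and the algorithm may evict pages (other than $p_t$) so that the set $S_t$ of pages in the cache after serving the request satisfies $f(S_t)\le k$. The cost is the sum of $c(p)$ over eviction events. $f$ is supermodular if $f(S)+f(S')\le f(S\cup S')+f(S\cap S')$ for all $S,S'\subseteq\mathcal{P}$. A randomized online algorithm is $\rho$-competitive if on every request sequence its expected cost is at most $\rho$ times the optimal offline cost.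
   Formalization: Each log x in the bound is taken as ln(1+x); read literally the bound is 0 when μ=1 (or when c_max=c_min and f(P)=1), where evictions can be forced and no 0-competitive algorithm exists. For arguments at least 2 only the constant changes. *)

theory Defs
  imports "HOL-Probability.Probability"
begin

locale nonlinear_paging =
  fixes P :: "'p set" and c :: "'p \<Rightarrow> real" and f :: "'p set \<Rightarrow> nat" and k :: nat
  assumes finite_pages: "finite P"
    and cost_pos: "p \<in> P \<Longrightarrow> 0 < c p"
    and feasibility_mono: "mono_on (Pow P) f"
    and singleton_feasible: "p \<in> P \<Longrightarrow> f {p} \<le> k"

locale supermodular_paging = nonlinear_paging +
  assumes supermodular:
    "\<lbrakk>S \<subseteq> P; S' \<subseteq> P\<rbrakk> \<Longrightarrow> f S + f S' \<le> f (S \<union> S') + f (S \<inter> S')"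

text \<open>
  A cache \<^term>\<open>S\<close> may become \<^term>\<open>T\<close> when \<^term>\<open>p\<close> is requested: only the requested page
  is fetched, it is not evicted, and the resulting cache is feasible.
\<close>

definition legal_step :: "('p set \<Rightarrow> nat) \<Rightarrow> nat \<Rightarrow> 'p set \<Rightarrow> 'p \<Rightarrow> 'p set \<Rightarrow> bool" where
  "legal_step f k S p T \<longleftrightarrow> p \<in> T \<and> T \<subseteq> insert p S \<and> f T \<le> k"

text \<open>
  A schedule lists the caches held after each request has been served; the first argument
  of type \<^typ>\<open>'p set\<close> is the cache held before the first of the listed requests.
\<close>

fun schedule :: "('p set \<Rightarrow> nat) \<Rightarrow> nat \<Rightarrow> 'p set \<Rightarrow> 'p list \<Rightarrow> 'p set list \<Rightarrow> bool" where
  "schedule f k S [] [] \<longleftrightarrow> True"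
| "schedule f k S (p # ps) (T # Ts) \<longleftrightarrow> legal_step f k S p T \<and> schedule f k T ps Ts"
| "schedule f k S _ _ \<longleftrightarrow> False"

fun eviction_cost :: "('p \<Rightarrow> real) \<Rightarrow> 'p set \<Rightarrow> 'p set list \<Rightarrow> real" where
  "eviction_cost c S [] = 0"
| "eviction_cost c S (T # Ts) = (\<Sum>p\<in>S - T. c p) + eviction_cost c T Ts"

definition opt_cost ::
    "('p \<Rightarrow> real) \<Rightarrow> ('p set \<Rightarrow> nat) \<Rightarrow> nat \<Rightarrow> 'p list \<Rightarrow> real" where
  "opt_cost c f k ps = (INF Ts\<in>{Ts. schedule f k {} ps Ts}. eviction_cost c {} Ts)"

text \<open>
  A randomized online algorithm chooses the next cache at random, given the past requests, the
  past caches (both in chronological order) and the current request. Since the whole history is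
  available, an algorithm with additional private randomness or memory induces one of this form
  with the same distribution of schedules on every request sequence (condition on the history).
\<close>

type_synonym 'p randomized_algorithm = "'p list \<Rightarrow> 'p set list \<Rightarrow> 'p \<Rightarrow> 'p set pmf"

definition online_algorithm ::
    "'p set \<Rightarrow> ('p set \<Rightarrow> nat) \<Rightarrow> nat \<Rightarrow> 'p randomized_algorithm \<Rightarrow> bool" where
  "online_algorithm P f k A \<longleftrightarrow>
     (\<forall>ps Ts p. set ps \<subseteq> P \<longrightarrow> schedule f k {} ps Ts \<longrightarrow> p \<in> P \<longrightarrow>
        (\<forall>T\<in>set_pmf (A ps Ts p). legal_step f k (last ({} # Ts)) p T))"

text \<open>
  \<open>run A ps Ts qs\<close> is the distribution of the complete schedule when the requests \<^term>\<open>qs\<close>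
  arrive after the history \<^term>\<open>ps\<close>, \<^term>\<open>Ts\<close>.
\<close>

fun run ::
    "'p randomized_algorithm \<Rightarrow> 'p list \<Rightarrow> 'p set list \<Rightarrow> 'p list \<Rightarrow> 'p set list pmf" where
  "run A ps Ts [] = return_pmf Ts"
| "run A ps Ts (q # qs) = bind_pmf (A ps Ts q) (\<lambda>T. run A (ps @ [q]) (Ts @ [T]) qs)"

definition expected_cost ::
    "('p \<Rightarrow> real) \<Rightarrow> 'p randomized_algorithm \<Rightarrow> 'p list \<Rightarrow> real" where
  "expected_cost c A ps = measure_pmf.expectation (run A [] [] ps) (eviction_cost c {})"

definition competitive ::
    "'p set \<Rightarrow> ('p \<Rightarrow> real) \<Rightarrow> ('p set \<Rightarrow> nat) \<Rightarrow> nat \<Rightarrow> real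
      \<Rightarrow> 'p randomized_algorithm \<Rightarrow> bool" where
  "competitive P c f k \<rho> A \<longleftrightarrow>
     (\<forall>ps. set ps \<subseteq> P \<longrightarrow> expected_cost c A ps \<le> \<rho> * opt_cost c f k ps)"

definition max_cache_size :: "'p set \<Rightarrow> ('p set \<Rightarrow> nat) \<Rightarrow> nat \<Rightarrow> nat" where
  "max_cache_size P f k = Max (card ` {S. S \<subseteq> P \<and> f S \<le> k})"

definition c_max :: "'p set \<Rightarrow> ('p \<Rightarrow> real) \<Rightarrow> real" where
  "c_max P c = Max (c ` P)"

definition c_min :: "'p set \<Rightarrow> ('p \<Rightarrow> real) \<Rightarrow> real" where
  "c_min P c = Min (c ` P)"

text \<open>
  Logarithms inside a big-O bound are shifted by one in their argument. For arguments at least 2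
  this only changes the constant. Without the shift the bound would vanish, and can be wrong, if
  the largest feasible cache has size 1, or if all costs are equal and \<^term>\<open>f P = 1\<close>.
\<close>

definition competitive_bound ::
    "'p set \<Rightarrow> ('p \<Rightarrow> real) \<Rightarrow> ('p set \<Rightarrow> nat) \<Rightarrow> nat \<Rightarrow> real" where
  "competitive_bound P c f k =
     (ln (1 + real (max_cache_size P f k)))\<^sup>2 * ln (1 + c_max P c / c_min P c * real (f P))"

end

theory Submission imports Defs begin

text \<open>
  In terms of the pages kept in the cache, a set \<open>A\<close> has the excess \<open>max 0 (f A - k)\<close>, which is
  again supermodular. Let \<open>x p\<close> be the extent to which page \<open>p\<close> is evicted. Every integral eviction
  pattern satisfies, for all sets \<open>A\<close> of pages, the covering inequality that \<open>x\<close> weighted by the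
  marginal excesses in \<open>A\<close> is at least the excess of \<open>A\<close>.

  Fractionally, multiplicative updates with additive term of order \<open>1 / \<mu>\<close> restore violated
  inequalities, and a logarithmic potential bounds their cost by \<open>O(log \<mu>)\<close> times the optimum.
  The updates may be restricted to inequalities with small total gain, because a violated
  inequality always yields one of these: either it has small gain itself, or some set of \<open>\<mu> + 1\<close>
  pages is hardly evicted.

  For rounding, keep each page independently with probability \<open>(1 - x p) ^ n\<close>. One factor \<open>1 - x p\<close>
  halves the expected excess, so the kept set is infeasible with probability at most \<open>f P / 2 ^ n\<close>.
  If it is infeasible, only its light pages are kept, those with \<open>x p < 1 / (\<mu> + 1)\<close>; the light
  pages always form a feasible set. The kept set can only become infeasible when a page outside it
  is requested, which is independent of the infeasibility, so the cost of these failures is charged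
  to the fractional cost. With \<open>n\<close> of order \<open>log (\<mu> f(P) c_max / c_min)\<close> the total is \<open>O(n)\<close> times
  the fractional cost.
\<close>

section \<open>Small steps, a logarithm bound and compactness\<close>

lemma small_step_exists:
  fixes a b v :: "'a \<Rightarrow> real"
  assumes "finite A" "\<And>p. p \<in> A \<Longrightarrow> a p < b p"
  shows "\<exists>e>0. \<forall>p\<in>A. a p + e * v p < b p"
proof -
  have "\<forall>\<^sub>F e in at_right 0. \<forall>p\<in>A. a p + e * v p < b p"
  proof (intro eventually_ball_finite assms(1) ballI)
    fix p assume "p \<in> A"
    have "((\<lambda>e. a p + e * v p) \<longlongrightarrow> a p + 0 * v p) (at_right 0)"
      by (intro tendsto_intros)
    then show "\<forall>\<^sub>F e in at_right 0. a p + e * v p < b p"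
      using assms(2)[OF \<open>p \<in> A\<close>] by (intro order_tendstoD(2)) auto
  qed
  moreover have "\<forall>\<^sub>F e::real in at_right 0. 0 < e" by (rule eventually_at_right_less)
  ultimately have "\<forall>\<^sub>F e in at_right 0. 0 < e \<and> (\<forall>p\<in>A. a p + e * v p < b p)"
    by eventually_elim simp
  then show ?thesis by (metis (mono_tags, lifting) eventually_happens trivial_limit_at_right_real)
qed

lemma half_le_ln_one_plus:
  fixes z :: real
  assumes "0 \<le> z" "z \<le> 1/2"
  shows "z / 2 \<le> ln (1 + z)"
proof -
  have "z * z \<le> z * (1/2)" using assms by (intro mult_left_mono)
  moreover have "z - z\<^sup>2 \<le> ln (1 + z)" using assms by (intro ln_one_plus_pos_lower_bound) auto
  ultimately show ?thesis by (simp add: power2_eq_square)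
qed

text \<open>Tychonoff's theorem, since functions on \<open>'a\<close> carry the product topology. It
  supplies the maximiser in \<open>fractional_step_exists\<close>.\<close>

lemma compact_box:
  fixes a b :: "'a \<Rightarrow> real"
  shows "compact (Pi UNIV (\<lambda>p. {a p..b p}))"
proof -
  have "compactin (product_topology (\<lambda>_. euclidean) UNIV) (PiE UNIV (\<lambda>p. {a p..b p}))"
    unfolding compactin_PiE by (auto simp: compactin_euclidean_iff)
  then show ?thesis by (simp add: euclidean_product_topology compactin_euclidean_iff PiE_UNIV_domain)
qed

section \<open>Covering inequalities\<close>

locale nonempty_paging = supermodular_paging P c f k
  for P :: "'p set" and c :: "'p \<Rightarrow> real" and f :: "'p set \<Rightarrow> nat" and k :: nat +
  assumes nonempty: "P \<noteq> {}"
begin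

abbreviation mu :: nat where "mu \<equiv> max_cache_size P f k"

definition excess :: "'p set \<Rightarrow> real" where
  "excess A = real (f A - k)"

definition gain :: "'p set \<Rightarrow> 'p \<Rightarrow> real" where
  "gain A p = excess A - excess (A - {p})"

text \<open>Knapsack-cover inequalities, with \<open>x p\<close> the evicted fraction of
  \<open>p\<close>.\<close>

definition covers :: "('p \<Rightarrow> real) \<Rightarrow> bool" where
  "covers x \<longleftrightarrow> (\<forall>A\<subseteq>P. excess A \<le> (\<Sum>p\<in>A. gain A p * x p))"

lemma f_mono: "A \<subseteq> B \<Longrightarrow> B \<subseteq> P \<Longrightarrow> f A \<le> f B"
  using feasibility_mono unfolding mono_on_def by (meson PowI order_trans)

lemma empty_feasible: "f {} \<le> k"
  using nonempty singleton_feasible f_mono[of "{}"]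
  by (metis all_not_in_conv bot.extremum empty_subsetI insert_subset order_trans)

lemma excess_nonneg: "0 \<le> excess A"
  by (simp add: excess_def)

lemma excess_eq_0_iff: "excess A = 0 \<longleftrightarrow> f A \<le> k"
  by (simp add: excess_def)

lemma excess_pos_iff: "0 < excess A \<longleftrightarrow> k < f A"
  by (simp add: excess_def)

lemma excess_mono: "A \<subseteq> B \<Longrightarrow> B \<subseteq> P \<Longrightarrow> excess A \<le> excess B"
  unfolding excess_def using f_mono[of A B] by (simp add: diff_le_mono)

lemma gain_nonneg: "A \<subseteq> P \<Longrightarrow> 0 \<le> gain A p"
  unfolding gain_def using excess_mono[of "A - {p}" A] by auto

lemma gain_le_excess: "gain A p \<le> excess A"
  unfolding gain_def using excess_nonneg[of "A - {p}"] by simp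

lemma gain_notin: "p \<notin> A \<Longrightarrow> gain A p = 0"
  by (simp add: gain_def)

text \<open>Supermodularity for \<open>B - {p}\<close> and \<open>A\<close> says that marginals of
  \<open>f\<close> grow with the set. Truncation at \<open>k\<close> preserves this because it is
  convex and increasing and \<open>f\<close> is monotone.\<close>

lemma gain_mono:
  assumes "A \<subseteq> B" "B \<subseteq> P"
  shows "gain A p \<le> gain B p"
proof (cases "p \<in> A")
  case False
  then show ?thesis using gain_nonneg assms by (simp add: gain_notin)
next
  case True
  have 1: "(B - {p}) \<union> A = B" "(B - {p}) \<inter> A = A - {p}" using True assms by auto
  have "f (B - {p}) + f A \<le> f B + f (A - {p})"
    using supermodular[of "B - {p}" A] assms unfolding 1 by auto
  moreover have "f (A - {p}) \<le> f A" "f (B - {p}) \<le> f B" "f A \<le> f B" "f (A - {p}) \<le> f (B - {p})"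
    using assms by (auto intro!: f_mono)
  ultimately show ?thesis
    unfolding gain_def excess_def
    by (cases "k \<le> f A"; cases "k \<le> f B"; cases "k \<le> f (A - {p})"; cases "k \<le> f (B - {p})")
       (auto simp: of_nat_diff)
qed

text \<open>Telescoping: the pages of \<open>D\<close> leave one at a time, and each loss is a gain
  in a subset of \<open>A\<close>, so \<open>gain_mono\<close> applies.\<close>

lemma excess_diff_le_gain:
  assumes "D \<subseteq> A" "A \<subseteq> P"
  shows "excess A - excess (A - D) \<le> (\<Sum>p\<in>D. gain A p)"
proof -
  have "finite D" using assms finite_pages by (meson finite_subset)
  then show ?thesis using assms(1)
  proof (induction D)
    case (insert p D)
    have "excess (A - D) - excess (A - insert p D) = gain (A - D) p"
      unfolding gain_def by (metis Diff_insert2 Diff_insert)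
    also have "\<dots> \<le> gain A p" using assms by (intro gain_mono) auto
    finally show ?case using insert by simp
  qed simp
qed

text \<open>Validity of the covering inequalities for integral solutions: when everything outside a
  feasible \<open>S\<close> is evicted, \<open>A \<inter> S\<close> has no excess left.\<close>

lemma excess_le_gain_outside:
  assumes "A \<subseteq> P" "S \<subseteq> P" "f S \<le> k"
  shows "excess A \<le> (\<Sum>p\<in>A - S. gain A p)"
proof -
  have "excess (A \<inter> S) \<le> excess S" using assms by (intro excess_mono) auto
  also have "\<dots> = 0" using assms by (simp add: excess_eq_0_iff)
  finally show ?thesis
    using excess_diff_le_gain[of "A - S" A] assms by (simp add: Diff_Diff_Int)
qed

lemma card_le_mu:
  assumes "S \<subseteq> P" "f S \<le> k"
  shows "card S \<le> mu"
  unfolding max_cache_size_def using assms finite_pages by (intro Max_ge) auto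

lemma mu_pos: "1 \<le> mu"
proof -
  obtain p where "p \<in> P" using nonempty by auto
  then show ?thesis using card_le_mu[of "{p}"] singleton_feasible by auto
qed

lemma excess_pos_card: "S \<subseteq> P \<Longrightarrow> mu < card S \<Longrightarrow> 0 < excess S"
  using card_le_mu[of S] by (meson excess_pos_iff not_le)

text \<open>Threshold between light and heavy pages: \<open>mu + 1\<close> values below it sum to
  less than 1.\<close>

definition tau :: real where "tau = 1 / (real mu + 1)"

text \<open>Half of \<open>tau\<close>. In \<open>violated_small_gain\<close> the light gains amount
  to at most \<open>mu\<close> and the heavy ones to at most \<open>mu + 1\<close> times the excess;
  \<open>1 / delta\<close> exceeds the total.\<close>

definition delta :: real where "delta = 1 / (2 * real mu + 2)"

lemma tau_pos: "0 < tau" and tau_less_1: "tau < 1" and delta_pos: "0 < delta"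
  using mu_pos by (auto simp: tau_def delta_def)

text \<open>Every gain is at most \<open>excess Z\<close>, and the at most \<open>mu + 1\<close>
  light values sum to less than 1. Negative values are possible here and are replaced by 0.\<close>

lemma sum_gain_light:
  assumes "Z \<subseteq> P" "card Z \<le> mu + 1" "\<And>p. p \<in> Z \<Longrightarrow> x p < tau" "0 < excess Z"
  shows "(\<Sum>p\<in>Z. gain Z p * x p) < excess Z"
proof -
  have fin: "finite Z" using assms(1) finite_pages finite_subset by blast
  have ne: "Z \<noteq> {}" using assms(4) empty_feasible by (auto simp: excess_pos_iff)
  have *: "(\<Sum>p\<in>Z. gain Z p * x p) \<le> (\<Sum>p\<in>Z. excess Z * max 0 (x p))"
  proof (rule sum_mono)
    fix p
    have "gain Z p * x p \<le> gain Z p * max 0 (x p)"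
      using gain_nonneg[OF assms(1)] by (intro mult_left_mono) auto
    also have "\<dots> \<le> excess Z * max 0 (x p)" by (intro mult_right_mono gain_le_excess) auto
    finally show "gain Z p * x p \<le> excess Z * max 0 (x p)" .
  qed
  have "(\<Sum>p\<in>Z. max 0 (x p)) < (\<Sum>p\<in>Z. tau)"
    using fin ne assms(3) tau_pos by (intro sum_strict_mono) auto
  also have "\<dots> \<le> (real mu + 1) * tau"
    using assms(2) tau_pos by (simp add: mult_right_mono)
  also have "\<dots> = 1" by (simp add: tau_def)
  finally have "excess Z * (\<Sum>p\<in>Z. max 0 (x p)) < excess Z * 1"
    using assms(4) by (intro mult_strict_left_mono)
  with * show ?thesis by (simp add: sum_distrib_left)
qed

text \<open>Otherwise some set of at most \<open>mu + 1\<close> light pages has positive excess,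
  because any \<open>mu + 1\<close> pages do, and \<open>sum_gain_light\<close> shows its covering
  inequality to be violated.\<close>

lemma light_feasible:
  assumes "covers x"
  shows "f {p \<in> P. x p < tau} \<le> k"
proof (rule ccontr)
  let ?A = "{p \<in> P. x p < tau}"
  assume "\<not> ?thesis"
  then have pos: "0 < excess ?A" by (simp add: excess_pos_iff)
  obtain Z where Z: "Z \<subseteq> ?A" "card Z \<le> mu + 1" "0 < excess Z"
  proof (cases "card ?A \<le> mu + 1")
    case True
    with pos that show ?thesis by blast
  next
    case False
    then obtain Z where "Z \<subseteq> ?A" "card Z = mu + 1"
      by (metis (no_types, lifting) nat_le_linear obtain_subset_with_card_n)
    then show ?thesis using that[of Z] excess_pos_card[of Z] by auto
  qed
  have "(\<Sum>p\<in>Z. gain Z p * x p) < excess Z"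
    using Z by (intro sum_gain_light) auto
  moreover have "Z \<subseteq> P" using Z by auto
  ultimately show False using assms unfolding covers_def by (meson not_le)
qed

text \<open>
  Only violated inequalities whose gains sum to a small multiple of \<^term>\<open>mu\<close> times the excess may drive the
  multiplicative updates; otherwise \<^term>\<open>delta\<close> would have to depend on the number of pages.
\<close>

lemma violated_small_gain:
  assumes nc: "\<not> covers x" and x01: "\<And>p. p \<in> P \<Longrightarrow> 0 \<le> x p \<and> x p \<le> 1"
  obtains A where "A \<subseteq> P" "\<And>p. p \<in> A \<Longrightarrow> x p < 1"
    "(\<Sum>p\<in>A. gain A p * x p) < excess A" "delta * (\<Sum>p\<in>A. gain A p) \<le> excess A"
proof (cases "mu + 1 \<le> card {p \<in> P. x p < tau}")
  case True
  then obtain Z where Z: "Z \<subseteq> {p \<in> P. x p < tau}" "card Z = mu + 1"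
    using obtain_subset_with_card_n[OF True] by metis
  have ZP: "Z \<subseteq> P" using Z by auto
  have pos: "0 < excess Z" using Z by (intro excess_pos_card) auto
  have light: "x p < tau" if "p \<in> Z" for p using Z that by auto
  have viol: "(\<Sum>p\<in>Z. gain Z p * x p) < excess Z"
    using Z light by (intro sum_gain_light ZP pos) auto
  have "(\<Sum>p\<in>Z. gain Z p) \<le> real (card Z) * excess Z"
    by (rule sum_bounded_above) (rule gain_le_excess)
  also have "\<dots> = (real mu + 1) * excess Z" using Z by simp
  finally have "delta * (\<Sum>p\<in>Z. gain Z p) \<le> delta * ((real mu + 1) * excess Z)"
    using delta_pos by (intro mult_left_mono) auto
  also have "\<dots> = excess Z / 2" by (simp add: delta_def field_simps)
  also have "\<dots> \<le> excess Z" using pos by simp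
  finally show ?thesis
    using that[OF ZP _ viol] light tau_less_1 by fastforce
next
  case False
  obtain A where A: "A \<subseteq> P" "(\<Sum>p\<in>A. gain A p * x p) < excess A"
    using nc unfolding covers_def by (auto simp: not_le)
  have finA: "finite A" using A finite_pages finite_subset by blast
  define B where "B = {p \<in> A. x p < 1}"
  have BA: "B \<subseteq> A" "B \<subseteq> P" using A by (auto simp: B_def)
  have finB: "finite B" using BA finA finite_subset by blast
  have "excess A - excess B \<le> (\<Sum>p\<in>A - B. gain A p)"
    using excess_diff_le_gain[of "A - B" A] A BA by (simp add: double_diff)
  also have "\<dots> = (\<Sum>p\<in>A - B. gain A p * x p)"
    using x01 A by (intro sum.cong) (force simp: B_def)+
  finally have 1: "excess A - excess B \<le> (\<Sum>p\<in>A - B. gain A p * x p)" .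
  have "(\<Sum>p\<in>B. gain B p * x p) \<le> (\<Sum>p\<in>B. gain A p * x p)"
    using x01 BA A by (intro sum_mono mult_right_mono gain_mono) auto
  also have "\<dots> = (\<Sum>p\<in>A. gain A p * x p) - (\<Sum>p\<in>A - B. gain A p * x p)"
    using finA BA by (simp add: sum_diff)
  also have "\<dots> < excess B" using 1 A by linarith
  finally have viol: "(\<Sum>p\<in>B. gain B p * x p) < excess B" .
  \<comment> \<open>At most \<open>mu\<close> pages of \<open>B\<close> are light, each with gain at
    most the excess. For the heavy ones, \<open>tau\<close> times the gains is at most the left side
    of the violated inequality.\<close>
  let ?l = "{p \<in> B. x p < tau}" and ?h = "{p \<in> B. tau \<le> x p}"
  have "card ?l \<le> card {p \<in> P. x p < tau}"
    using BA finite_pages by (intro card_mono) auto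
  then have cl: "card ?l \<le> mu" using False by simp
  have "(\<Sum>p\<in>?l. gain B p) \<le> real (card ?l) * excess B"
    by (rule sum_bounded_above) (rule gain_le_excess)
  also have "\<dots> \<le> real mu * excess B"
    using cl excess_nonneg by (intro mult_right_mono) auto
  finally have l: "(\<Sum>p\<in>?l. gain B p) \<le> real mu * excess B" .
  have "tau * (\<Sum>p\<in>?h. gain B p) = (\<Sum>p\<in>?h. gain B p * tau)"
    by (simp add: sum_distrib_left mult.commute)
  also have "\<dots> \<le> (\<Sum>p\<in>?h. gain B p * x p)"
    using gain_nonneg[OF BA(2)] by (intro sum_mono mult_left_mono) auto
  also have "\<dots> \<le> (\<Sum>p\<in>B. gain B p * x p)"
    using finB gain_nonneg[OF BA(2)] x01 BA by (intro sum_mono2) auto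
  also have "\<dots> \<le> excess B" using viol by simp
  finally have h: "(\<Sum>p\<in>?h. gain B p) \<le> (real mu + 1) * excess B"
    by (simp add: tau_def field_simps)
  have "(\<Sum>p\<in>B. gain B p) = (\<Sum>p\<in>?l \<union> ?h. gain B p)"
    by (rule sum.cong) auto
  also have "\<dots> = (\<Sum>p\<in>?l. gain B p) + (\<Sum>p\<in>?h. gain B p)"
    using finB by (intro sum.union_disjoint) auto
  also have "\<dots> \<le> (2 * real mu + 2) * excess B"
    using l h excess_nonneg[of B] by (simp add: algebra_simps)
  finally have "delta * (\<Sum>p\<in>B. gain B p) \<le> delta * ((2 * real mu + 2) * excess B)"
    using delta_pos by (intro mult_left_mono) auto
  also have "\<dots> = excess B" by (simp add: delta_def)
  finally show ?thesis using that[OF BA(2) _ viol] by (auto simp: B_def)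
qed

section \<open>Fractional paging\<close>

text \<open>
  Among all vectors above \<^term>\<open>x\<close> that satisfy the potential inequality against every
  feasible cache, take one with maximal sum. If it violated a covering inequality, a small
  multiplicative step along that inequality would increase the sum and keep the potential
  inequality.
\<close>

lemma fractional_step_exists:
  assumes q: "q \<in> P" and x01: "\<And>p. p \<in> P \<Longrightarrow> 0 \<le> x p \<and> x p \<le> 1" and xq: "x q = 0"
  shows "\<exists>y. covers y \<and> (\<forall>p\<in>P. x p \<le> y p \<and> y p \<le> 1) \<and> y q = 0 \<and>
    (\<forall>S\<subseteq>P. q \<in> S \<longrightarrow> f S \<le> k \<longrightarrow>
       (\<Sum>p\<in>P. c p * (y p - x p)) \<le> 4 * (\<Sum>p\<in>P - S. c p * (ln (y p + delta) - ln (x p + delta))))"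
proof -
  define F where "F = {S. S \<subseteq> P \<and> q \<in> S \<and> f S \<le> k}"
  define u where "u = (\<lambda>p. if p \<in> P - {q} then 1 else x p)"
  define lhs where "lhs = (\<lambda>y. \<Sum>p\<in>P. c p * (y p - x p))"
  \<comment> \<open>\<open>max 0\<close> keeps the argument of the logarithm positive off the box,
    so that \<open>rhs\<close> is continuous everywhere and the constraint sets are closed. On the
    box it changes nothing.\<close>
  define rhs where "rhs = (\<lambda>S y. 4 * (\<Sum>p\<in>P - S. c p * (ln (max 0 (y p) + delta) - ln (x p + delta))))"
  define X where "X = Pi UNIV (\<lambda>p. {x p..u p}) \<inter> (\<Inter>S\<in>F. {y. lhs y \<le> rhs S y})"
  have cont: "continuous_on UNIV lhs" "continuous_on UNIV (rhs S)" for S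
    unfolding lhs_def rhs_def using delta_pos
    by (auto intro!: continuous_intros simp: add_nonneg_pos less_imp_neq[THEN not_sym])
  have "compact X" unfolding X_def
    by (intro compact_Int_closed compact_box closed_INT ballI closed_Collect_le cont)
  moreover have xX: "x \<in> X"
    using x01 by (auto simp: X_def u_def lhs_def rhs_def max_def sum.neutral)
  moreover have "continuous_on X (\<lambda>y. \<Sum>p\<in>P. y p)"
    by (intro continuous_intros) (rule continuous_on_subset[OF continuous_on_product_coordinates], simp)
  ultimately obtain y where yX: "y \<in> X" and ymax: "\<And>z. z \<in> X \<Longrightarrow> (\<Sum>p\<in>P. z p) \<le> (\<Sum>p\<in>P. y p)"
    using continuous_attains_sup[of X "\<lambda>y. \<Sum>p\<in>P. y p"] by blast
  have box: "x p \<le> y p" "y p \<le> u p" for p using yX by (auto simp: X_def Pi_iff)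
  have y01: "0 \<le> y p \<and> y p \<le> 1" if "p \<in> P" for p
    using box[of p] x01[OF that] xq by (auto simp: u_def that split: if_splits)
  have yq: "y q = 0" using box[of q] xq by (auto simp: u_def)
  have ineq: "lhs y \<le> rhs S y" if "S \<in> F" for S using yX that by (auto simp: X_def)
  have "covers y"
  proof (rule ccontr)
    assume "\<not> covers y"
    then obtain A where A: "A \<subseteq> P" "\<And>p. p \<in> A \<Longrightarrow> y p < 1"
      "(\<Sum>p\<in>A. gain A p * y p) < excess A" "delta * (\<Sum>p\<in>A. gain A p) \<le> excess A"
      using y01 violated_small_gain[of y] by blast
    \<comment> \<open>The requested page is not moved. Nothing is lost, as every cache in
      \<open>F\<close> contains \<open>q\<close>, so that \<open>A - S = B - S\<close>.\<close>
    define B where "B = A - {q}"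
    have finA: "finite A" using A(1) finite_pages finite_subset by blast
    have BP: "B \<subseteq> P" "finite B" "q \<notin> B" using A(1) finA by (auto simp: B_def)
    have gn: "0 \<le> gain A p" for p using A(1) by (rule gain_nonneg)
    define v where "v = (\<lambda>p. gain A p / c p)"
    have cpos: "0 < c p" if "p \<in> B" for p using that BP cost_pos by auto
    have vn: "0 \<le> v p" if "p \<in> B" for p using gn cpos[OF that] by (simp add: v_def)
    have excess_pos: "0 < excess A"
    proof -
      have "0 \<le> (\<Sum>p\<in>A. gain A p * y p)" using gn y01 A(1) by (intro sum_nonneg) auto
      then show ?thesis using A(3) by simp
    qed
    \<comment> \<open>One strict inequality encodes both demands on the step size: no page passes 1,
      and each relative increase \<open>e * v p\<close> is at most 1/2, as
      \<open>half_le_ln_one_plus\<close> requires.\<close>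
    have "\<exists>e>0. \<forall>p\<in>B. max (y p - 1) (- 1 / 2) + e * (v p * (y p + delta) + v p) < 0"
      using A(2) BP by (intro small_step_exists) (auto simp: B_def max_def)
    then obtain e where e: "0 < e" and
      e': "\<And>p. p \<in> B \<Longrightarrow> max (y p - 1) (- 1 / 2) + e * (v p * (y p + delta) + v p) < 0" by blast
    have e1: "y p + e * v p * (y p + delta) \<le> 1" and e2: "e * v p \<le> 1 / 2" if p: "p \<in> B" for p
    proof -
      have "p \<in> P" using p BP by auto
      then have "0 \<le> e * v p" "0 \<le> e * v p * (y p + delta)"
        using vn[OF p] e y01[of p] delta_pos by auto
      then show "y p + e * v p * (y p + delta) \<le> 1" "e * v p \<le> 1 / 2"
        using e'[OF p] by (auto simp: algebra_simps max_def split: if_splits)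
    qed
    \<comment> \<open>Multiplicative update with rate gain per cost; the shift by
      \<open>delta\<close> lets pages at 0 move.\<close>
    define z where "z = (\<lambda>p. if p \<in> B then y p + e * v p * (y p + delta) else y p)"
    have inc: "0 \<le> e * v p * (y p + delta)" if "p \<in> B" for p
      using vn[OF that] e y01[of p] delta_pos BP that by auto
    have yz: "y p \<le> z p" for p using inc by (auto simp: z_def)
    have gain_outside: "excess A \<le> (\<Sum>p\<in>B - S. gain A p)" if "S \<in> F" for S
    proof -
      have "A - S = B - S" using that by (auto simp: F_def B_def)
      then show ?thesis using excess_le_gain_outside[OF A(1), of S] that by (auto simp: F_def)
    qed
    have "lhs z \<le> rhs S z" if S: "S \<in> F" for S
    proof -
      have "(\<Sum>p\<in>P. c p * (z p - y p)) = (\<Sum>p\<in>B. c p * (z p - y p))"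
        using BP finite_pages by (intro sum.mono_neutral_right) (auto simp: z_def)
      also have "\<dots> = e * (\<Sum>p\<in>B. gain A p * (y p + delta))"
        unfolding sum_distrib_left
      proof (rule sum.cong)
        fix p assume p: "p \<in> B"
        show "c p * (z p - y p) = e * (gain A p * (y p + delta))"
          using p cpos[OF p] by (simp add: z_def v_def)
      qed simp
      also have "\<dots> \<le> e * (\<Sum>p\<in>A. gain A p * (y p + delta))"
        using finA gn y01 A(1) delta_pos e
        by (intro mult_left_mono sum_mono2) (auto simp: B_def add_nonneg_nonneg)
      also have "\<dots> = e * ((\<Sum>p\<in>A. gain A p * y p) + delta * (\<Sum>p\<in>A. gain A p))"
        by (simp add: algebra_simps sum.distrib sum_distrib_left)
      \<comment> \<open>The violation bounds the first sum by the excess, the small total gain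
        bounds the second.\<close>
      also have "\<dots> \<le> e * (2 * excess A)" using A(3,4) e by (intro mult_left_mono) auto
      finally have l: "lhs z - lhs y \<le> 2 * e * excess A"
        by (simp add: lhs_def algebra_simps sum_subtractf)
      have pt: "(if p \<in> B then e * gain A p / 2 else 0) \<le>
          c p * (ln (max 0 (z p) + delta) - ln (max 0 (y p) + delta))" if p: "p \<in> P - S" for p
      proof (cases "p \<in> B")
        case True
        have yd: "0 < y p + delta" using y01[of p] p delta_pos by auto
        have "z p + delta = (y p + delta) * (1 + e * v p)"
          using True by (simp add: z_def algebra_simps)
        then have "ln (z p + delta) = ln (y p + delta) + ln (1 + e * v p)"
          using yd vn[OF True] e by (simp add: ln_mult_pos add_pos_nonneg)
        moreover have "e * v p / 2 \<le> ln (1 + e * v p)"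
          using vn[OF True] e e2[OF True] by (intro half_le_ln_one_plus) auto
        moreover have "max 0 (z p) = z p" "max 0 (y p) = y p"
          using y01[of p] p yz[of p] by auto
        ultimately have "e * v p / 2 \<le> ln (max 0 (z p) + delta) - ln (max 0 (y p) + delta)"
          by simp
        then have "c p * (e * v p / 2) \<le> c p * (ln (max 0 (z p) + delta) - ln (max 0 (y p) + delta))"
          using cpos[OF True] by (intro mult_left_mono) auto
        moreover have "c p * (e * v p / 2) = e * gain A p / 2"
          using cpos[OF True] by (simp add: v_def)
        ultimately show ?thesis unfolding if_P[OF True] by linarith
      qed (simp add: z_def)
      \<comment> \<open>The cost-weighted logarithms outside \<open>S\<close> rise by at least
        \<open>e * excess A / 2\<close>, the cost by at most \<open>2 * e * excess A\<close>; hence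
        the factor 4 in \<open>rhs\<close>.\<close>
      have "e * excess A / 2 \<le> e * (\<Sum>p\<in>B - S. gain A p) / 2"
        using gain_outside[OF S] e by simp
      also have "\<dots> = (\<Sum>p\<in>B - S. e * gain A p / 2)" by (simp add: sum_distrib_left sum_divide_distrib)
      also have "\<dots> = (\<Sum>p\<in>P - S. if p \<in> B then e * gain A p / 2 else 0)"
        using BP finite_pages by (intro sum.mono_neutral_cong_left) auto
      also have "\<dots> \<le> (\<Sum>p\<in>P - S. c p * (ln (max 0 (z p) + delta) - ln (max 0 (y p) + delta)))"
        by (intro sum_mono pt)
      finally have "2 * e * excess A \<le> rhs S z - rhs S y"
        by (simp add: rhs_def algebra_simps sum_subtractf sum.distrib)
      then show ?thesis using l ineq[OF S] by linarith
    qed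
    moreover have "x p \<le> z p \<and> z p \<le> u p" for p
      using box[of p] yz[of p] e1[of p] BP by (auto simp: z_def u_def)
    ultimately have "z \<in> X" by (auto simp: X_def)
    moreover have "(\<Sum>p\<in>P. y p) < (\<Sum>p\<in>P. z p)"
    proof (rule sum_strict_mono_ex1[OF finite_pages])
      \<comment> \<open>The cache holding only \<open>q\<close> shows that some page of
        \<open>B\<close> has positive gain and therefore moves.\<close>
      have "{q} \<in> F" using q singleton_feasible by (auto simp: F_def)
      from gain_outside[OF this] have "0 < (\<Sum>p\<in>B. gain A p)"
        using excess_pos BP(3) by simp
      then obtain p where p: "p \<in> B" "0 < gain A p" 
        by (meson not_le sum_nonpos)
      then have "0 < e * v p * (y p + delta)"
        using e cpos[OF p(1)] y01[of p] BP delta_pos by (auto simp: v_def intro!: mult_pos_pos add_nonneg_pos)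
      then show "\<exists>p\<in>P. y p < z p" using p BP by (auto simp: z_def)
    qed (use yz in auto)
    ultimately show False using ymax by (meson not_le)
  qed
  moreover have "(\<Sum>p\<in>P. c p * (y p - x p)) \<le> 4 * (\<Sum>p\<in>P - S. c p * (ln (y p + delta) - ln (x p + delta)))"
    if "S \<subseteq> P" "q \<in> S" "f S \<le> k" for S
  proof -
    have "lhs y \<le> rhs S y" using that by (intro ineq) (auto simp: F_def)
    moreover have "rhs S y = 4 * (\<Sum>p\<in>P - S. c p * (ln (y p + delta) - ln (x p + delta)))"
      unfolding rhs_def using y01 by (intro arg_cong[where f = "(*) 4"] sum.cong) (auto simp: max_def)
    ultimately show ?thesis by (simp add: lhs_def)
  qed
  ultimately show ?thesis using box y01 yq by (intro exI[of _ y]) auto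
qed

end

section \<open>Schedules extended by a last request\<close>

lemma schedule_snoc:
  "schedule f k S (ps @ [q]) Ts \<longleftrightarrow>
     (\<exists>Us T. Ts = Us @ [T] \<and> schedule f k S ps Us \<and> legal_step f k (last (S # Us)) q T)"
proof (induction ps arbitrary: S Ts)
  case Nil
  show ?case
  proof (cases Ts)
    case (Cons T Us)
    then show ?thesis by (cases Us) (auto simp: Cons_eq_append_conv)
  qed auto
next
  case (Cons p ps)
  show ?case
  proof (cases Ts)
    case (Cons T Us)
    have "schedule f k S ((p # ps) @ [q]) Ts \<longleftrightarrow>
        legal_step f k S p T \<and> (\<exists>Vs V. Us = Vs @ [V] \<and> schedule f k T ps Vs \<and> legal_step f k (last (T # Vs)) q V)"
      using Cons.IH by (simp add: \<open>Ts = T # Us\<close>)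
    also have "\<dots> \<longleftrightarrow> (\<exists>Us' V. Ts = Us' @ [V] \<and> schedule f k S (p # ps) Us' \<and> legal_step f k (last (S # Us')) q V)"
    proof (intro iffI; elim exE conjE)
      fix Vs V assume "legal_step f k S p T" "Us = Vs @ [V]" "schedule f k T ps Vs" "legal_step f k (last (T # Vs)) q V"
      then show "\<exists>Us' V. Ts = Us' @ [V] \<and> schedule f k S (p # ps) Us' \<and> legal_step f k (last (S # Us')) q V"
        using \<open>Ts = T # Us\<close> by (intro exI[of _ "T # Vs"] exI[of _ V]) auto
    next
      fix Us' V assume *: "Ts = Us' @ [V]" "schedule f k S (p # ps) Us'" "legal_step f k (last (S # Us')) q V"
      then show "legal_step f k S p T \<and> (\<exists>Vs V. Us = Vs @ [V] \<and> schedule f k T ps Vs \<and> legal_step f k (last (T # Vs)) q V)"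
        using \<open>Ts = T # Us\<close> by (cases Us') auto
    qed
    finally show ?thesis .
  qed auto
qed

lemma schedule_subset:
  "schedule f k S ps Ts \<Longrightarrow> T \<in> set Ts \<Longrightarrow> T \<subseteq> S \<union> set ps"
  by (induction f k S ps Ts rule: schedule.induct) (fastforce simp: legal_step_def)+

lemma eviction_cost_snoc:
  "eviction_cost c S (Ts @ [T]) = eviction_cost c S Ts + (\<Sum>p\<in>last (S # Ts) - T. c p)"
  by (induction Ts arbitrary: S) auto

section \<open>The online fractional solution and its cost\<close>

context nonempty_paging
begin

definition valid_step :: "('p \<Rightarrow> real) \<Rightarrow> 'p \<Rightarrow> ('p \<Rightarrow> real) \<Rightarrow> bool" where
  "valid_step x q y \<longleftrightarrow> covers y \<and> (\<forall>p\<in>P. x p \<le> y p \<and> y p \<le> 1) \<and> y q = 0 \<and>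
    (\<forall>S\<subseteq>P. q \<in> S \<longrightarrow> f S \<le> k \<longrightarrow>
       (\<Sum>p\<in>P. c p * (y p - x p)) \<le> 4 * (\<Sum>p\<in>P - S. c p * (ln (y p + delta) - ln (x p + delta))))"

text \<open>The argument of \<open>frac\<close> and of the functions below lists the requests latest first.\<close>

primrec frac :: "'p list \<Rightarrow> 'p \<Rightarrow> real" where
  "frac [] = (\<lambda>_. 1)"
| "frac (q # r) = (SOME y. valid_step ((frac r)(q := 0)) q y)"

text \<open>The claims need a joint induction: the bounds guarantee that a valid step exists for
  \<open>SOME\<close> to choose, and the valid step carries the bounds to the next vector.\<close>

lemma frac_bounds_and_step:
  "set r \<subseteq> P \<Longrightarrow> (\<forall>p\<in>P. 0 \<le> frac r p \<and> frac r p \<le> 1) \<and>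
     (\<forall>q\<in>P. valid_step ((frac r)(q := 0)) q (frac (q # r)))"
proof (induction r)
  have *: "\<forall>q\<in>P. valid_step (x(q := 0)) q (SOME y. valid_step (x(q := 0)) q y)"
    if "\<forall>p\<in>P. 0 \<le> x p \<and> x p \<le> 1" for x
  proof
    fix q assume q: "q \<in> P"
    have "\<exists>y. valid_step (x(q := 0)) q y"
      unfolding valid_step_def using that by (intro fractional_step_exists q) auto
    then show "valid_step (x(q := 0)) q (SOME y. valid_step (x(q := 0)) q y)" by (rule someI_ex)
  qed
  { case Nil
    show ?case using *[of "\<lambda>_. 1"] by (simp del: fun_upd_apply)
  next
    case (Cons q r)
    then have "valid_step ((frac r)(q := 0)) q (frac (q # r))" "\<forall>p\<in>P. 0 \<le> frac r p"
      by (auto simp del: fun_upd_apply frac.simps)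
    then have "\<forall>p\<in>P. 0 \<le> frac (q # r) p \<and> frac (q # r) p \<le> 1"
      unfolding valid_step_def by (metis fun_upd_apply order_refl order_trans)
    with *[OF this] show ?case by (simp del: fun_upd_apply)
  }
qed

lemma frac_bounds:
  assumes "set r \<subseteq> P" "p \<in> P"
  shows "0 \<le> frac r p" "frac r p \<le> 1"
  using frac_bounds_and_step[OF assms(1)] assms(2) by auto

lemma frac_valid_step:
  "set r \<subseteq> P \<Longrightarrow> q \<in> P \<Longrightarrow> valid_step ((frac r)(q := 0)) q (frac (q # r))"
  using frac_bounds_and_step[of r] by blast

declare frac.simps(2) [simp del]

lemma frac_requested: "set r \<subseteq> P \<Longrightarrow> q \<in> P \<Longrightarrow> frac (q # r) q = 0"
  using frac_valid_step[of r q] by (simp add: valid_step_def)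

lemma frac_mono: "set r \<subseteq> P \<Longrightarrow> q \<in> P \<Longrightarrow> p \<in> P \<Longrightarrow> p \<noteq> q \<Longrightarrow> frac r p \<le> frac (q # r) p"
  using frac_valid_step[of r q] by (auto simp: valid_step_def)

lemma frac_covers: "set r \<subseteq> P \<Longrightarrow> q \<in> P \<Longrightarrow> covers (frac (q # r))"
  using frac_valid_step[of r q] by (simp add: valid_step_def)

lemma frac_unrequested: "set r \<subseteq> P \<Longrightarrow> p \<in> P - set r \<Longrightarrow> frac r p = 1"
proof (induction r)
  case (Cons q r)
  then show ?case using frac_mono[of r q p] frac_bounds[of "q # r" p] by auto
qed simp

text \<open>Settled amounts: when a page is requested again, its evicted fraction is charged for
  good. A first request is free, since the initial value 1 stands for no eviction.\<close>

primrec paid :: "'p list \<Rightarrow> real" where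
  "paid [] = 0"
| "paid (q # r) = paid r + (if q \<in> set r then c q * frac r q else 0)"

text \<open>Adds the open amounts of requested pages, so that each increase is charged when it
  happens, as \<open>frac_cost_Cons\<close> shows.\<close>

definition frac_cost :: "'p list \<Rightarrow> real" where
  "frac_cost r = paid r + (\<Sum>p\<in>set r. c p * frac r p)"

lemma frac_cost_Cons:
  assumes "set r \<subseteq> P" "q \<in> P"
  shows "frac_cost (q # r) = frac_cost r + (\<Sum>p\<in>P. c p * (frac (q # r) p - ((frac r)(q := 0)) p))"
proof -
  have fin: "finite P" by (rule finite_pages)
  have zero: "frac (q # r) p = 1 \<and> frac r p = 1" if "p \<in> P - set (q # r)" for p
    using that assms frac_unrequested[of "q # r" p] frac_unrequested[of r p] by auto
  have "(\<Sum>p\<in>P. c p * (frac (q # r) p - ((frac r)(q := 0)) p)) =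
      (\<Sum>p\<in>set (q # r). c p * (frac (q # r) p - ((frac r)(q := 0)) p))"
    using fin assms zero by (intro sum.mono_neutral_right) auto
  also have "\<dots> = (\<Sum>p\<in>set (q # r). c p * frac (q # r) p) - (\<Sum>p\<in>set (q # r). c p * ((frac r)(q := 0)) p)"
    by (simp add: algebra_simps sum_subtractf)
  also have "(\<Sum>p\<in>set (q # r). c p * ((frac r)(q := 0)) p) = (\<Sum>p\<in>set r - {q}. c p * frac r p)"
    by (intro sum.mono_neutral_cong_right) auto
  also have "\<dots> = (\<Sum>p\<in>set r. c p * frac r p) - (if q \<in> set r then c q * frac r q else 0)"
    by (auto simp: sum_diff1)
  finally show ?thesis unfolding frac_cost_def by simp
qed

lemma paid_nonneg: "set r \<subseteq> P \<Longrightarrow> 0 \<le> paid r"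
  by (induction r) (use frac_bounds cost_pos in \<open>auto simp: less_imp_le\<close>)

lemma frac_cost_mono: "set r \<subseteq> P \<Longrightarrow> q \<in> P \<Longrightarrow> frac_cost r \<le> frac_cost (q # r)"
  using frac_valid_step[of r q] cost_pos
  by (subst frac_cost_Cons) (auto simp: valid_step_def less_imp_le intro!: sum_nonneg mult_nonneg_nonneg)

lemma frac_cost_ge: "set r \<subseteq> P \<Longrightarrow> p \<in> set r \<Longrightarrow> c p * frac r p \<le> frac_cost r"
proof -
  assume r: "set r \<subseteq> P" "p \<in> set r"
  have "c p * frac r p \<le> (\<Sum>p\<in>set r. c p * frac r p)"
    using r frac_bounds cost_pos by (intro member_le_sum) (auto simp: less_imp_le subset_iff)
  then show ?thesis using paid_nonneg[OF r(1)] by (simp add: frac_cost_def)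
qed

text \<open>The second summand is a potential: the logarithmic room left below 1 for pages outside
  the offline cache. By \<open>valid_step\<close> against that cache it pays for each fractional
  step, and an offline eviction of \<open>p\<close> adds at most \<open>c p\<close> times
  \<open>ln (1 + delta) - ln delta\<close>.\<close>

lemma frac_cost_potential:
  assumes "schedule f k {} ps Ts" "set ps \<subseteq> P"
  shows "frac_cost (rev ps) + 4 * (\<Sum>p\<in>P - last ({} # Ts). c p * (ln (1 + delta) - ln (frac (rev ps) p + delta)))
    \<le> 4 * (ln (1 + delta) - ln delta) * eviction_cost c {} Ts"
  using assms
proof (induction ps arbitrary: Ts rule: rev_induct)
  case Nil
  then have "Ts = []" by (cases Ts) auto
  then show ?case by (simp add: frac_cost_def)
next
  case (snoc q ps)
  obtain Us T where Ts: "Ts = Us @ [T]" "schedule f k {} ps Us" "legal_step f k (last ({} # Us)) q T"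
    using snoc.prems by (auto simp: schedule_snoc)
  define S where "S = last ({} # Us)"
  define x where "x = frac (rev ps)"
  define y where "y = frac (q # rev ps)"
  have rP: "set (rev ps) \<subseteq> P" "q \<in> P" using snoc.prems by auto
  have "T \<in> set Ts" by (simp add: Ts)
  then have TP: "T \<subseteq> P" using schedule_subset[OF snoc.prems(1), of T] snoc.prems(2) by auto
  have qT: "q \<in> T" "f T \<le> k" using Ts(3) by (auto simp: legal_step_def)
  have SP: "S \<subseteq> P"
  proof (cases "Us = []")
    case False
    then have "S \<in> set Us" by (simp add: S_def)
    then show ?thesis using schedule_subset[OF Ts(2), of S] rP by auto
  qed (simp add: S_def)
  have x01: "0 \<le> x p \<and> x p \<le> 1" if "p \<in> P" for p
    using frac_bounds[OF rP(1) that] by (simp add: x_def)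
  let ?pot = "\<lambda>p. c p * (ln (1 + delta) - ln (x p + delta))"
  have pot: "0 \<le> ?pot p" "?pot p \<le> c p * (ln (1 + delta) - ln delta)" if "p \<in> P" for p
    using x01[OF that] delta_pos cost_pos[OF that] by auto
  have "frac_cost (q # rev ps) = frac_cost (rev ps) + (\<Sum>p\<in>P. c p * (y p - (x(q := 0)) p))"
    using rP by (simp add: frac_cost_Cons x_def y_def)
  also have "(\<Sum>p\<in>P. c p * (y p - (x(q := 0)) p))
      \<le> 4 * (\<Sum>p\<in>P - T. c p * (ln (y p + delta) - ln ((x(q := 0)) p + delta)))"
    using frac_valid_step[OF rP] TP qT unfolding valid_step_def x_def y_def by blast
  \<comment> \<open>Resetting \<open>q\<close> to 0 is invisible here because the offline cache
    \<open>T\<close> contains \<open>q\<close>.\<close>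
  also have "(\<Sum>p\<in>P - T. c p * (ln (y p + delta) - ln ((x(q := 0)) p + delta)))
      = (\<Sum>p\<in>P - T. ?pot p) - (\<Sum>p\<in>P - T. c p * (ln (1 + delta) - ln (y p + delta)))"
    unfolding sum_subtractf[symmetric] using qT by (intro sum.cong) (auto simp: algebra_simps)
  finally have "frac_cost (q # rev ps) + 4 * (\<Sum>p\<in>P - T. c p * (ln (1 + delta) - ln (y p + delta)))
      \<le> frac_cost (rev ps) + 4 * (\<Sum>p\<in>P - T. ?pot p)"
    by simp
  also have "(\<Sum>p\<in>P - T. ?pot p) \<le> (\<Sum>p\<in>(P - S) \<union> (S - T). ?pot p)"
    using finite_pages SP pot(1) by (intro sum_mono2) (auto intro: finite_subset)
  also have "\<dots> = (\<Sum>p\<in>P - S. ?pot p) + (\<Sum>p\<in>S - T. ?pot p)"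
    using finite_pages SP by (intro sum.union_disjoint) (auto intro: finite_subset)
  also have "(\<Sum>p\<in>S - T. ?pot p) \<le> (\<Sum>p\<in>S - T. c p * (ln (1 + delta) - ln delta))"
    using SP pot(2) by (intro sum_mono) auto
  also have "\<dots> = (ln (1 + delta) - ln delta) * (\<Sum>p\<in>S - T. c p)"
    by (simp add: sum_distrib_right mult.commute)
  finally have "frac_cost (q # rev ps) + 4 * (\<Sum>p\<in>P - T. c p * (ln (1 + delta) - ln (y p + delta)))
      \<le> (frac_cost (rev ps) + 4 * (\<Sum>p\<in>P - S. ?pot p)) + 4 * ((ln (1 + delta) - ln delta) * (\<Sum>p\<in>S - T. c p))"
    by simp
  also have "\<dots> \<le> 4 * (ln (1 + delta) - ln delta) * eviction_cost c {} Us + 4 * ((ln (1 + delta) - ln delta) * (\<Sum>p\<in>S - T. c p))"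
    using snoc.IH[OF Ts(2)] rP by (simp add: S_def x_def)
  also have "\<dots> = 4 * (ln (1 + delta) - ln delta) * eviction_cost c {} Ts"
    by (simp only: Ts(1) eviction_cost_snoc S_def) (simp only: algebra_simps)
  finally show ?case by (simp add: Ts(1) y_def)
qed

text \<open>The potential is nonnegative, and \<open>(1 + delta) / delta\<close> equals
  \<open>2 * real mu + 3\<close>.\<close>

lemma frac_cost_le_opt:
  assumes "schedule f k {} ps Ts" "set ps \<subseteq> P"
  shows "frac_cost (rev ps) \<le> 4 * ln (2 * real mu + 3) * eviction_cost c {} Ts"
proof -
  have "0 \<le> (\<Sum>p\<in>P - last ({} # Ts). c p * (ln (1 + delta) - ln (frac (rev ps) p + delta)))"
  proof (rule sum_nonneg)
    fix p assume "p \<in> P - last ({} # Ts)"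
    then have "p \<in> P" by auto
    then show "0 \<le> c p * (ln (1 + delta) - ln (frac (rev ps) p + delta))"
      using frac_bounds[of "rev ps" p] assms(2) delta_pos cost_pos[of p] by auto
  qed
  moreover have "ln (1 + delta) - ln delta = ln (2 * real mu + 3)"
  proof -
    have "(1 + delta) / delta = 2 * real mu + 3" by (simp add: delta_def field_simps)
    moreover have "ln ((1 + delta) / delta) = ln (1 + delta) - ln delta"
      using delta_pos by (intro ln_divide_pos) auto
    ultimately show ?thesis by simp
  qed
  ultimately show ?thesis using frac_cost_potential[OF assms] by simp
qed

end

section \<open>Random subsets\<close>

definition random_subset :: "'a set \<Rightarrow> ('a \<Rightarrow> real) \<Rightarrow> 'a set pmf" where
  "random_subset Q u = map_pmf (\<lambda>h. {p \<in> Q. h p}) (Pi_pmf Q False (\<lambda>p. bernoulli_pmf (u p)))"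

lemma bernoulli_pmf_one: "bernoulli_pmf 1 = return_pmf True"
proof (rule pmf_eqI)
  show "pmf (bernoulli_pmf 1) b = pmf (return_pmf True) b" for b by (cases b) auto
qed

lemma bernoulli_pmf_zero: "bernoulli_pmf 0 = return_pmf False"
proof (rule pmf_eqI)
  show "pmf (bernoulli_pmf 0) b = pmf (return_pmf False) b" for b by (cases b) auto
qed

lemma random_subset_empty: "random_subset {} u = return_pmf {}"
  by (simp add: random_subset_def)

lemma random_subset_insert:
  assumes "finite Q" "p \<notin> Q"
  shows "random_subset (insert p Q) u =
    bind_pmf (bernoulli_pmf (u p)) (\<lambda>b. map_pmf (\<lambda>R. if b then insert p R else R) (random_subset Q u))"
proof -
  have *: "{x \<in> insert p Q. (h(p := b)) x} = (if b then insert p {x \<in> Q. h x} else {x \<in> Q. h x})" for h b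
    using assms(2) by auto
  show ?thesis
    unfolding random_subset_def Pi_pmf_insert'[OF assms] map_bind_pmf map_return_pmf *
    by (simp add: map_pmf_def bind_assoc_pmf bind_return_pmf)
qed

lemma random_subset_cong: "(\<And>p. p \<in> Q \<Longrightarrow> u p = v p) \<Longrightarrow> random_subset Q u = random_subset Q v"
  unfolding random_subset_def by (intro arg_cong[where f = "map_pmf _"] Pi_pmf_cong) auto

lemma set_random_subset: "R \<in> set_pmf (random_subset Q u) \<Longrightarrow> R \<subseteq> Q"
  by (auto simp: random_subset_def)

lemma random_subset_prob_one:
  assumes "finite Q" "R \<in> set_pmf (random_subset Q u)" "p \<in> Q" "u p = 1"
  shows "p \<in> R"
  using assms set_Pi_pmf[OF assms(1), of False "\<lambda>p. bernoulli_pmf (u p)"]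
  by (fastforce simp: random_subset_def PiE_dflt_def bernoulli_pmf_one)

lemma random_subset_zero:
  assumes "finite Q"
  shows "random_subset Q (\<lambda>_. 0) = return_pmf {}"
  unfolding random_subset_def bernoulli_pmf_zero using assms by simp

lemma finite_random_subset: "finite Q \<Longrightarrow> finite (set_pmf (random_subset Q u))"
  by (rule finite_subset[of _ "Pow Q"]) (auto dest: set_random_subset)

lemma expectation_bind_finite:
  fixes h :: "'b \<Rightarrow> real"
  assumes "finite (set_pmf M)" "\<And>x. x \<in> set_pmf M \<Longrightarrow> finite (set_pmf (K x))"
  shows "measure_pmf.expectation (bind_pmf M K) h =
    measure_pmf.expectation M (\<lambda>x. measure_pmf.expectation (K x) h)"
  using assms by (subst pmf_expectation_bind[where A = "set_pmf M"])
    (auto simp: integral_measure_pmf[OF assms(1)])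

lemma expectation_mono_finite:
  fixes g h :: "'b \<Rightarrow> real"
  assumes "finite (set_pmf M)" "\<And>x. x \<in> set_pmf M \<Longrightarrow> g x \<le> h x"
  shows "measure_pmf.expectation M g \<le> measure_pmf.expectation M h"
  using assms by (intro integral_mono_AE integrable_measure_pmf_finite) (auto simp: AE_measure_pmf_iff)

lemma expectation_cong_pmf:
  fixes g h :: "'b \<Rightarrow> real"
  assumes "\<And>x. x \<in> set_pmf M \<Longrightarrow> g x = h x"
  shows "measure_pmf.expectation M g = measure_pmf.expectation M h"
  using assms by (intro integral_cong_AE) (auto simp: AE_measure_pmf_iff)

lemma expectation_random_subset_insert:
  fixes G :: "'a set \<Rightarrow> real"
  assumes "finite Q" "p \<notin> Q" "0 \<le> u p" "u p \<le> 1"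
  shows "measure_pmf.expectation (random_subset (insert p Q) u) G =
    u p * measure_pmf.expectation (random_subset Q u) (\<lambda>R. G (insert p R)) +
    (1 - u p) * measure_pmf.expectation (random_subset Q u) G"
  using assms
  by (subst random_subset_insert)
     (auto simp: expectation_bind_finite finite_random_subset)

lemma bernoulli_pmf_and:
  assumes "0 \<le> a" "a \<le> 1" "0 \<le> b" "b \<le> 1"
  shows "bind_pmf (bernoulli_pmf a) (\<lambda>x. map_pmf (\<lambda>y. x \<and> y) (bernoulli_pmf b)) = bernoulli_pmf (a * b)"
proof -
  have ab: "0 \<le> a * b" "a * b \<le> 1" using assms by (auto intro: mult_le_one)
  have eq: "map_pmf (\<lambda>y. x \<and> y) M = (if x then M else return_pmf False)" for x and M :: "bool pmf"
    by (cases x) (simp_all add: map_pmf_ident map_pmf_const)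
  show ?thesis unfolding eq
  proof (rule pmf_eqI)
    fix z
    show "pmf (bind_pmf (bernoulli_pmf a) (\<lambda>x. if x then bernoulli_pmf b else return_pmf False)) z =
        pmf (bernoulli_pmf (a * b)) z"
      using assms ab by (cases z) (auto simp: pmf_bind algebra_simps)
  qed
qed

text \<open>A page lies in both sets iff both its coins succeed, an event of the product
  probability. This serves both repeated thinning and the update of the private state.\<close>

lemma random_subset_inter:
  assumes "finite Q" "\<And>p. p \<in> Q \<Longrightarrow> 0 \<le> u p \<and> u p \<le> 1" "\<And>p. p \<in> Q \<Longrightarrow> 0 \<le> v p \<and> v p \<le> 1"
  shows "bind_pmf (random_subset Q u) (\<lambda>R. map_pmf ((\<inter>) R) (random_subset Q v)) =
    random_subset Q (\<lambda>p. u p * v p)"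
  using assms
proof (induction Q)
  case empty
  then show ?case by (simp add: random_subset_empty bind_return_pmf)
next
  case (insert p Q)
  define ins where "ins = (\<lambda>b R. if b then insert p R else R)"
  have split: "random_subset (insert p Q) w = bind_pmf (bernoulli_pmf (w p)) (\<lambda>b. map_pmf (ins b) (random_subset Q w))" for w
    using random_subset_insert[OF insert(1,2), of w] by (simp add: ins_def)
  have "bind_pmf (random_subset (insert p Q) u) (\<lambda>R. map_pmf ((\<inter>) R) (random_subset (insert p Q) v)) =
     bind_pmf (bernoulli_pmf (u p)) (\<lambda>b. bind_pmf (random_subset Q u) (\<lambda>R.
       bind_pmf (bernoulli_pmf (v p)) (\<lambda>b'. map_pmf (\<lambda>R'. ins b R \<inter> ins b' R') (random_subset Q v))))"
    by (simp add: split bind_assoc_pmf bind_map_pmf map_bind_pmf map_pmf_comp)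
  also have "\<dots> = bind_pmf (bernoulli_pmf (u p)) (\<lambda>b. bind_pmf (bernoulli_pmf (v p)) (\<lambda>b'.
       bind_pmf (random_subset Q u) (\<lambda>R. map_pmf (\<lambda>R'. ins b R \<inter> ins b' R') (random_subset Q v))))"
    by (subst bind_commute_pmf) (rule refl)
  also have "\<dots> = bind_pmf (bernoulli_pmf (u p)) (\<lambda>b. bind_pmf (bernoulli_pmf (v p)) (\<lambda>b'.
       bind_pmf (random_subset Q u) (\<lambda>R. map_pmf (\<lambda>R'. ins (b \<and> b') (R \<inter> R')) (random_subset Q v))))"
  proof (intro bind_pmf_cong refl map_pmf_cong)
    fix b b' R R' assume "R \<in> set_pmf (random_subset Q u)" "R' \<in> set_pmf (random_subset Q v)"
    then have "p \<notin> R" "p \<notin> R'" using insert(2) set_random_subset by blast+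
    then show "ins b R \<inter> ins b' R' = ins (b \<and> b') (R \<inter> R')" by (auto simp: ins_def)
  qed
  also have "\<dots> = bind_pmf (bernoulli_pmf (u p)) (\<lambda>b. bind_pmf (bernoulli_pmf (v p)) (\<lambda>b'.
       map_pmf (ins (b \<and> b')) (bind_pmf (random_subset Q u) (\<lambda>R. map_pmf ((\<inter>) R) (random_subset Q v)))))"
    by (simp add: map_bind_pmf map_pmf_comp)
  also have "bind_pmf (random_subset Q u) (\<lambda>R. map_pmf ((\<inter>) R) (random_subset Q v)) = random_subset Q (\<lambda>p. u p * v p)"
    using insert by auto
  also have "bind_pmf (bernoulli_pmf (u p)) (\<lambda>b. bind_pmf (bernoulli_pmf (v p)) (\<lambda>b'.
       map_pmf (ins (b \<and> b')) (random_subset Q (\<lambda>p. u p * v p)))) =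
     bind_pmf (bind_pmf (bernoulli_pmf (u p)) (\<lambda>x. map_pmf (\<lambda>y. x \<and> y) (bernoulli_pmf (v p))))
       (\<lambda>b. map_pmf (ins b) (random_subset Q (\<lambda>p. u p * v p)))"
    by (simp add: bind_assoc_pmf bind_map_pmf)
  also have "\<dots> = random_subset (insert p Q) (\<lambda>p. u p * v p)"
    using insert.prems by (simp add: bernoulli_pmf_and split)
  finally show ?case .
qed

lemma expectation_random_subset_mem:
  assumes "finite Q" "p \<in> Q" "0 \<le> u p" "u p \<le> 1"
  shows "measure_pmf.expectation (random_subset Q u) (\<lambda>R. of_bool (p \<in> R)) = u p"
proof -
  obtain S where S: "Q = insert p S" "p \<notin> S" using assms(2) by (meson mk_disjoint_insert)
  have "measure_pmf.expectation (random_subset S u) (\<lambda>R. of_bool (p \<in> R) :: real) =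
    measure_pmf.expectation (random_subset S u) (\<lambda>R. 0)"
    by (rule expectation_cong_pmf) (use S set_random_subset[of _ S] in auto)
  then show ?thesis
    using assms S by (simp add: expectation_random_subset_insert)
qed

text \<open>\<open>insert q R\<close> forgets the coin of \<open>q\<close>, so it is independent of
  the event \<open>q \<notin> R\<close>.\<close>

lemma expectation_random_subset_indep:
  fixes G :: "'a set \<Rightarrow> real"
  assumes "finite Q" "q \<in> Q" "0 \<le> u q" "u q \<le> 1"
  shows "measure_pmf.expectation (random_subset Q u) (\<lambda>R. of_bool (q \<notin> R) * G (insert q R)) =
    (1 - u q) * measure_pmf.expectation (random_subset Q u) (\<lambda>R. G (insert q R))"
proof -
  obtain S where S: "Q = insert q S" "q \<notin> S" using assms(2) by (meson mk_disjoint_insert)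
  have "measure_pmf.expectation (random_subset S u) (\<lambda>R. of_bool (q \<notin> R) * G (insert q R)) =
    measure_pmf.expectation (random_subset S u) (\<lambda>R. G (insert q R))"
    by (rule expectation_cong_pmf) (use S set_random_subset[of _ S] in auto)
  then show ?thesis
    using assms S by (simp add: expectation_random_subset_insert algebra_simps)
qed

lemma random_subset_insert_elem:
  assumes "finite Q" "q \<in> Q"
  shows "map_pmf (insert q) (random_subset Q u) = random_subset Q (u(q := 1))"
proof -
  obtain S where S: "Q = insert q S" "q \<notin> S" using assms(2) by (meson mk_disjoint_insert)
  have finS: "finite S" using assms(1) S by simp
  have 1: "random_subset S (u(q := 1)) = random_subset S u"
    using S by (intro random_subset_cong) auto
  have 2: "map_pmf (insert q) (map_pmf (\<lambda>R. if b then insert q R else R) M) = map_pmf (insert q) M" for b M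
    unfolding map_pmf_comp by (rule map_pmf_cong) auto
  have "map_pmf (insert q) (random_subset Q u) =
      bind_pmf (bernoulli_pmf (u q)) (\<lambda>b. map_pmf (insert q) (random_subset S u))"
    unfolding S(1) random_subset_insert[OF finS S(2)] map_bind_pmf 2 ..
  also have "\<dots> = map_pmf (insert q) (random_subset S u)" by (rule bind_pmf_const)
  also have "\<dots> = random_subset Q (u(q := 1))"
    unfolding S(1) random_subset_insert[OF finS S(2)] 1
    by (simp add: bernoulli_pmf_one bind_return_pmf)
  finally show ?thesis .
qed

section \<open>Expected excess after independent thinning\<close>

context nonempty_paging
begin

text \<open>
  The pages are removed one after the other. By \<open>gain_mono\<close>, the expected loss of excess caused
  by \<^term>\<open>p\<close> is at least \<^term>\<open>x p\<close> times its gain with respect to the final set.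
\<close>

lemma expected_excess_loss:
  assumes "finite Q" "Q \<subseteq> P" "A \<subseteq> P" "\<And>p. p \<in> P \<Longrightarrow> 0 \<le> x p \<and> x p \<le> 1"
  shows "measure_pmf.expectation (random_subset Q (\<lambda>p. 1 - x p))
      (\<lambda>R. excess (A - (Q - R)) + (\<Sum>p\<in>Q. x p * gain (A - (Q - R)) p)) \<le> excess A"
  using assms(1,2)
proof (induction Q)
  case empty
  then show ?case by (simp add: random_subset_empty)
next
  case (insert q Q)
  let ?M = "random_subset Q (\<lambda>p. 1 - x p)"
  have fin: "finite (set_pmf ?M)" using insert by (intro finite_random_subset)
  have xq: "0 \<le> x q" "x q \<le> 1" using insert assms(4) by auto
  define B where "B = (\<lambda>R. A - (Q - R))"
  define s where "s = (\<lambda>C. \<Sum>p\<in>Q. x p * gain C p)"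
  have int: "integrable ?M h" for h :: "_ \<Rightarrow> real" using fin by (rule integrable_measure_pmf_finite)
  have BP: "B R \<subseteq> P" for R using assms(3) by (auto simp: B_def)
  have 1: "excess (A - (insert q Q - insert q R)) + (\<Sum>p\<in>insert q Q. x p * gain (A - (insert q Q - insert q R)) p)
      = excess (B R) + s (B R) + x q * gain (B R) q" if "R \<in> set_pmf ?M" for R
  proof -
    have "A - (insert q Q - insert q R) = B R" using insert(2) by (auto simp: B_def)
    then show ?thesis using insert(1,2) by (simp add: s_def)
  qed
  \<comment> \<open>Evicting \<open>q\<close> loses exactly its gain in \<open>B R\<close>; its own
    gain becomes 0 and the gains of the other pages can only shrink.\<close>
  have 2: "excess (A - (insert q Q - R)) + (\<Sum>p\<in>insert q Q. x p * gain (A - (insert q Q - R)) p)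
      \<le> excess (B R) - gain (B R) q + s (B R)" if "R \<in> set_pmf ?M" for R
  proof -
    have "q \<notin> R" using that insert(2) set_random_subset by blast
    then have eq: "A - (insert q Q - R) = B R - {q}" by (auto simp: B_def)
    have "s (B R - {q}) \<le> s (B R)" unfolding s_def
      using BP insert.prems assms(4) by (intro sum_mono mult_left_mono gain_mono) auto
    then show ?thesis unfolding eq using insert(1,2)
      by (simp add: s_def gain_notin) (simp add: gain_def)
  qed
  have "measure_pmf.expectation (random_subset (insert q Q) (\<lambda>p. 1 - x p))
      (\<lambda>R. excess (A - (insert q Q - R)) + (\<Sum>p\<in>insert q Q. x p * gain (A - (insert q Q - R)) p))
    = (1 - x q) * measure_pmf.expectation ?M (\<lambda>R. excess (A - (insert q Q - insert q R)) + (\<Sum>p\<in>insert q Q. x p * gain (A - (insert q Q - insert q R)) p))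
      + x q * measure_pmf.expectation ?M (\<lambda>R. excess (A - (insert q Q - R)) + (\<Sum>p\<in>insert q Q. x p * gain (A - (insert q Q - R)) p))"
    using insert(1,2) xq by (subst expectation_random_subset_insert) auto
  also have "\<dots> \<le> (1 - x q) * measure_pmf.expectation ?M (\<lambda>R. excess (B R) + s (B R) + x q * gain (B R) q)
      + x q * measure_pmf.expectation ?M (\<lambda>R. excess (B R) - gain (B R) q + s (B R))"
    using xq by (intro add_mono mult_left_mono expectation_mono_finite fin eq_refl[OF 1] 2) auto
  \<comment> \<open>The gain of \<open>q\<close> has coefficient
    \<open>(1 - x q) * x q - x q\<close>, which is not positive.\<close>
  also have "\<dots> = measure_pmf.expectation ?M (\<lambda>R. excess (B R) + s (B R))
      - x q * x q * measure_pmf.expectation ?M (\<lambda>R. gain (B R) q)"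
    by (simp add: int algebra_simps)
  also have "\<dots> \<le> measure_pmf.expectation ?M (\<lambda>R. excess (B R) + s (B R))"
    using BP by (auto intro!: mult_nonneg_nonneg integral_nonneg_AE gain_nonneg simp: xq)
  also have "\<dots> \<le> excess A" using insert by (simp add: B_def s_def)
  finally show ?case .
qed

text \<open>In \<open>expected_excess_loss\<close> with \<open>Q = P\<close>, the covering
  inequality of the remaining set \<open>A \<inter> R\<close> bounds the weighted gains from below
  by its excess, so that excess counts twice.\<close>

lemma expected_excess_half:
  assumes "A \<subseteq> P" "\<And>p. p \<in> P \<Longrightarrow> 0 \<le> x p \<and> x p \<le> 1" "covers x"
  shows "measure_pmf.expectation (random_subset P (\<lambda>p. 1 - x p)) (\<lambda>R. excess (A \<inter> R)) \<le> excess A / 2"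
proof -
  let ?M = "random_subset P (\<lambda>p. 1 - x p)"
  have "2 * measure_pmf.expectation ?M (\<lambda>R. excess (A \<inter> R)) = measure_pmf.expectation ?M (\<lambda>R. 2 * excess (A \<inter> R))"
    by simp
  also have "\<dots> \<le> measure_pmf.expectation ?M (\<lambda>R. excess (A - (P - R)) + (\<Sum>p\<in>P. x p * gain (A - (P - R)) p))"
  proof (intro expectation_mono_finite finite_random_subset finite_pages)
    fix R
    have eq: "A - (P - R) = A \<inter> R" using assms(1) by auto
    have "excess (A \<inter> R) \<le> (\<Sum>p\<in>A \<inter> R. gain (A \<inter> R) p * x p)"
      using assms(1,3) unfolding covers_def by blast
    also have "\<dots> \<le> (\<Sum>p\<in>P. gain (A \<inter> R) p * x p)"
      using assms finite_pages by (intro sum_mono2 mult_nonneg_nonneg gain_nonneg) auto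
    finally show "2 * excess (A \<inter> R) \<le> excess (A - (P - R)) + (\<Sum>p\<in>P. x p * gain (A - (P - R)) p)"
      unfolding eq by (simp add: mult.commute)
  qed
  also have "\<dots> \<le> excess A" using assms finite_pages by (intro expected_excess_loss) auto
  finally show ?thesis by simp
qed

text \<open>By \<open>random_subset_inter\<close> the powers describe \<open>n\<close> independent
  rounds of thinning, and each round halves the expected excess of whatever set is left.\<close>

lemma expected_excess_rounds:
  assumes x01: "\<And>p. p \<in> P \<Longrightarrow> 0 \<le> x p \<and> x p \<le> 1" and x: "covers x"
  shows "measure_pmf.expectation (random_subset P (\<lambda>p. (1 - x p) ^ n)) excess \<le> excess P / 2 ^ n"
proof (induction n)
  case 0
  have "measure_pmf.expectation (random_subset P (\<lambda>p. 1)) excess \<le> measure_pmf.expectation (random_subset P (\<lambda>p. 1)) (\<lambda>_. excess P)"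
    using finite_pages by (intro expectation_mono_finite finite_random_subset excess_mono) (auto dest: set_random_subset)
  then show ?case by simp
next
  case (Suc n)
  let ?M = "random_subset P (\<lambda>p. (1 - x p) ^ n)" and ?N = "random_subset P (\<lambda>p. 1 - x p)"
  have fin: "finite (set_pmf ?M)" "finite (set_pmf ?N)" using finite_pages by (auto intro: finite_random_subset)
  have "random_subset P (\<lambda>p. (1 - x p) ^ Suc n) = bind_pmf ?M (\<lambda>R. map_pmf ((\<inter>) R) ?N)"
    using x01 finite_pages by (subst random_subset_inter) (auto simp: power_le_one mult.commute)
  then have "measure_pmf.expectation (random_subset P (\<lambda>p. (1 - x p) ^ Suc n)) excess
    = measure_pmf.expectation ?M (\<lambda>R. measure_pmf.expectation ?N (\<lambda>R'. excess (R \<inter> R')))"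
    using fin by (simp add: expectation_bind_finite)
  also have "\<dots> \<le> measure_pmf.expectation ?M (\<lambda>R. excess R / 2)"
    using x01 x fin by (intro expectation_mono_finite expected_excess_half) (auto dest: set_random_subset)
  also have "\<dots> \<le> excess P / 2 ^ Suc n" using Suc by simp
  finally show ?case .
qed

text \<open>Markov's inequality: the excess is an integer, hence at least 1 on infeasible
  sets.\<close>

lemma infeasible_prob:
  assumes "\<And>p. p \<in> P \<Longrightarrow> 0 \<le> x p \<and> x p \<le> 1" "covers x"
  shows "measure_pmf.expectation (random_subset P (\<lambda>p. (1 - x p) ^ n)) (\<lambda>R. of_bool (k < f R)) \<le> real (f P) / 2 ^ n"
proof -
  have "measure_pmf.expectation (random_subset P (\<lambda>p. (1 - x p) ^ n)) (\<lambda>R. of_bool (k < f R))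
    \<le> measure_pmf.expectation (random_subset P (\<lambda>p. (1 - x p) ^ n)) excess"
    using finite_pages by (intro expectation_mono_finite finite_random_subset) (auto simp: excess_def of_bool_def)
  also have "\<dots> \<le> excess P / 2 ^ n" using assms by (rule expected_excess_rounds)
  also have "\<dots> \<le> real (f P) / 2 ^ n" by (intro divide_right_mono) (auto simp: excess_def)
  finally show ?thesis .
qed

end

section \<open>Algorithms with private state\<close>

text \<open>
  An algorithm with a private state of type \<open>'s\<close> is given by its initial state and a kernel,
  which takes the past requests (latest first), the state, the past caches and the current
  request. Conditioning the state on the past caches yields an algorithm without private state.
\<close>

primrec state_run ::
  "('p list \<Rightarrow> 's \<Rightarrow> 'p set list \<Rightarrow> 'p \<Rightarrow> ('s \<times> 'p set) pmf)
    \<Rightarrow> 's \<Rightarrow> 'p list \<Rightarrow> ('s \<times> 'p set list) pmf" where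
  "state_run K s [] = return_pmf (s, [])"
| "state_run K s (q # r) = bind_pmf (state_run K s r)
     (\<lambda>z. map_pmf (\<lambda>w. (fst w, snd z @ [snd w])) (K r (fst z) (snd z) q))"

definition forget_state ::
  "('p list \<Rightarrow> 's \<Rightarrow> 'p set list \<Rightarrow> 'p \<Rightarrow> ('s \<times> 'p set) pmf)
    \<Rightarrow> 's \<Rightarrow> 'p randomized_algorithm" where
  "forget_state K s ps Ts q =
     (if Ts \<in> snd ` set_pmf (state_run K s (rev ps))
      then bind_pmf (cond_pmf (state_run K s (rev ps)) {z. snd z = Ts})
        (\<lambda>z. map_pmf snd (K (rev ps) (fst z) Ts q))
      else return_pmf {q})"

lemma run_snoc:
  "run A ps Ts (qs @ [q]) = bind_pmf (run A ps Ts qs) (\<lambda>Us. map_pmf (\<lambda>T. Us @ [T]) (A (ps @ qs) Us q))"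
proof (induction qs arbitrary: ps Ts)
  case Nil
  show ?case by (simp add: bind_return_pmf map_pmf_def)
next
  case (Cons p qs)
  show ?case by (simp add: Cons.IH bind_assoc_pmf)
qed

text \<open>Law of total probability: drawing a value of \<open>g\<close> and then conditioning on
  it gives back \<open>M\<close>.\<close>

lemma bind_cond_pmf_fibre:
  "bind_pmf (map_pmf g M) (\<lambda>a. cond_pmf M {z. g z = a}) = M"
proof (rule bind_cond_pmf_cancel)
  fix a z assume "a \<in> set_pmf (map_pmf g M)" "z \<in> set_pmf M" "g z = a"
  then show "measure M {z. g z = a} = measure (map_pmf g M) {a. g z = a}"
    by (auto simp: measure_map_pmf intro!: arg_cong[where f = "measure M"])
qed auto

text \<open>If the past caches have the right law, redrawing the state conditionally on them
  restores the joint law of state and caches, so the next cache has the right law too.\<close>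

lemma run_forget_state:
  "run (forget_state K s) [] [] ps = map_pmf snd (state_run K s (rev ps))"
proof (induction ps rule: rev_induct)
  case Nil
  show ?case by simp
next
  case (snoc q ps)
  define J where "J = state_run K s (rev ps)"
  have "run (forget_state K s) [] [] (ps @ [q]) =
      bind_pmf (map_pmf snd J) (\<lambda>Us. map_pmf (\<lambda>T. Us @ [T]) (forget_state K s ps Us q))"
    by (simp add: run_snoc snoc.IH J_def)
  also have "\<dots> = bind_pmf (map_pmf snd J) (\<lambda>Us. bind_pmf (cond_pmf J {z. snd z = Us})
      (\<lambda>z. map_pmf (\<lambda>w. snd z @ [snd w]) (K (rev ps) (fst z) (snd z) q)))"
  proof (intro bind_pmf_cong refl)
    fix Us assume "Us \<in> set_pmf (map_pmf snd J)"
    then have Us: "Us \<in> snd ` set_pmf J" by simp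
    then have ne: "set_pmf J \<inter> {z. snd z = Us} \<noteq> {}" by auto
    have "map_pmf (\<lambda>T. Us @ [T]) (forget_state K s ps Us q) =
        bind_pmf (cond_pmf J {z. snd z = Us}) (\<lambda>z. map_pmf (\<lambda>w. Us @ [snd w]) (K (rev ps) (fst z) Us q))"
      using Us by (simp add: forget_state_def J_def map_bind_pmf map_pmf_comp)
    also have "\<dots> = bind_pmf (cond_pmf J {z. snd z = Us})
        (\<lambda>z. map_pmf (\<lambda>w. snd z @ [snd w]) (K (rev ps) (fst z) (snd z) q))"
      using ne by (intro bind_pmf_cong refl) auto
    finally show "map_pmf (\<lambda>T. Us @ [T]) (forget_state K s ps Us q) = \<dots>" .
  qed
  also have "\<dots> = bind_pmf J (\<lambda>z. map_pmf (\<lambda>w. snd z @ [snd w]) (K (rev ps) (fst z) (snd z) q))"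
    unfolding bind_assoc_pmf[symmetric] bind_cond_pmf_fibre ..
  also have "\<dots> = map_pmf snd (state_run K s (rev (ps @ [q])))"
    by (simp add: J_def map_bind_pmf map_pmf_comp)
  finally show ?case .
qed

lemma finite_state_run:
  assumes "\<And>r s Ts q. finite (set_pmf (K r s Ts q))"
  shows "finite (set_pmf (state_run K s r))"
  using assms by (induction r) auto

text \<open>\<open>T = {q}\<close> is the default for histories of probability 0.
  \<open>online_algorithm\<close> demands a legal step there as well, which this is by
  \<open>singleton_feasible\<close>.\<close>

lemma set_forget_state:
  assumes "T \<in> set_pmf (forget_state K s ps Ts q)"
  shows "T = {q} \<or> (\<exists>u s'. (u, Ts) \<in> set_pmf (state_run K s (rev ps)) \<and> (s', T) \<in> set_pmf (K (rev ps) u Ts q))"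
proof (cases "Ts \<in> snd ` set_pmf (state_run K s (rev ps))")
  case True
  then have ne: "set_pmf (state_run K s (rev ps)) \<inter> {z. snd z = Ts} \<noteq> {}" by auto
  have "T \<in> set_pmf (bind_pmf (cond_pmf (state_run K s (rev ps)) {z. snd z = Ts})
      (\<lambda>z. map_pmf snd (K (rev ps) (fst z) Ts q)))"
    using assms True by (simp add: forget_state_def)
  then obtain z w where "z \<in> set_pmf (state_run K s (rev ps))" "snd z = Ts"
    "w \<in> set_pmf (K (rev ps) (fst z) Ts q)" "T = snd w"
    unfolding set_bind_pmf set_cond_pmf[OF ne] by auto
  then show ?thesis by (metis prod.collapse)
next
  case False
  then show ?thesis using assms by (simp add: forget_state_def)
qed

section \<open>Rounding\<close>

text \<open>\<open>n\<close> is the number of thinning rounds; it is positive so that a fully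
  evicted page has keeping probability \<open>0 ^ n = 0\<close>.\<close>

locale paging_rounding = nonempty_paging P c f k
  for P :: "'p set" and c :: "'p \<Rightarrow> real" and f :: "'p set \<Rightarrow> nat" and k :: nat +
  fixes n :: nat
  assumes n_pos: "0 < n"
begin

definition keep_prob :: "'p list \<Rightarrow> 'p \<Rightarrow> real" where
  "keep_prob r p = (1 - frac r p) ^ n"

text \<open>Only the requested page may be fetched, so the cache is cut down to the private state
  rather than set to it. Pages lost in an overflow stay out until requested again.\<close>

definition next_cache :: "'p list \<Rightarrow> 'p set \<Rightarrow> 'p set \<Rightarrow> 'p set" where
  "next_cache r B C = (if k < f B then C \<inter> B \<inter> {p \<in> P. frac r p < tau} else C \<inter> B)"

text \<open>
  The private state is a random set of pages that contains each page \<open>p\<close> independently with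
  probability \<open>keep_prob r p\<close>. Where the denominator is \<open>0\<close>, the keeping probability was already
  \<open>0\<close>, so the junk value of the quotient does not matter.
\<close>

definition kernel :: "'p list \<Rightarrow> 'p set \<Rightarrow> 'p set list \<Rightarrow> 'p \<Rightarrow> ('p set \<times> 'p set) pmf" where
  "kernel r B Ts q = map_pmf
     (\<lambda>K. (insert q B \<inter> K, next_cache (q # r) (insert q B \<inter> K) (insert q (last ({} # Ts)))))
     (random_subset P (\<lambda>p. ((1 - frac (q # r) p) / (1 - ((frac r)(q := 0)) p)) ^ n))"

abbreviation paging_run :: "'p list \<Rightarrow> ('p set \<times> 'p set list) pmf" where
  "paging_run \<equiv> state_run kernel {}"

lemma finite_kernel: "finite (set_pmf (kernel r B Ts q))"
  using finite_pages by (simp add: kernel_def finite_random_subset)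

lemma finite_paging_run: "finite (set_pmf (paging_run r))"
  by (intro finite_state_run finite_kernel)

lemma keep_prob_bounds: "set r \<subseteq> P \<Longrightarrow> p \<in> P \<Longrightarrow> 0 \<le> keep_prob r p \<and> keep_prob r p \<le> 1"
  using frac_bounds[of r p] by (simp add: keep_prob_def power_le_one)

lemma keep_prob_factor:
  assumes "set r \<subseteq> P" "q \<in> P" "p \<in> P"
  shows "((keep_prob r)(q := 1)) p * ((1 - frac (q # r) p) / (1 - ((frac r)(q := 0)) p)) ^ n = keep_prob (q # r) p"
    and "0 \<le> (1 - frac (q # r) p) / (1 - ((frac r)(q := 0)) p)"
    and "(1 - frac (q # r) p) / (1 - ((frac r)(q := 0)) p) \<le> 1"
proof -
  have b: "frac r p \<le> 1" "frac (q # r) p \<le> 1" "frac (q # r) q = 0"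
    using assms frac_bounds[of r p] frac_bounds[of "q # r" p] frac_requested by auto
  have m: "frac r p \<le> frac (q # r) p" if "p \<noteq> q" using assms that by (intro frac_mono)
  show "((keep_prob r)(q := 1)) p * ((1 - frac (q # r) p) / (1 - ((frac r)(q := 0)) p)) ^ n = keep_prob (q # r) p"
  proof (cases "p = q \<or> frac r p \<noteq> 1")
    case True
    then show ?thesis using b by (auto simp: keep_prob_def power_divide)
  next
    case False
    then have "frac (q # r) p = 1" using m b by auto
    then show ?thesis using False by (simp add: keep_prob_def n_pos)
  qed
  show "0 \<le> (1 - frac (q # r) p) / (1 - ((frac r)(q := 0)) p)"
    "(1 - frac (q # r) p) / (1 - ((frac r)(q := 0)) p) \<le> 1"
    using b m by (cases "p = q"; auto simp: divide_le_eq_1)+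
qed

text \<open>The state evolves independently of the caches. A request raises the probability of
  \<open>q\<close> to 1, and the random factor then turns the old probabilities into those of the
  new fractional vector.\<close>

lemma state_distribution:
  "set r \<subseteq> P \<Longrightarrow> map_pmf fst (paging_run r) = random_subset P (keep_prob r)"
proof (induction r)
  case Nil
  have "random_subset P (keep_prob []) = random_subset P (\<lambda>_. 0)"
    by (rule random_subset_cong) (simp add: keep_prob_def n_pos)
  then show ?case using finite_pages by (simp add: random_subset_zero)
next
  case (Cons q r)
  let ?\<rho> = "\<lambda>p. ((1 - frac (q # r) p) / (1 - ((frac r)(q := 0)) p)) ^ n"
  have r: "set r \<subseteq> P" "q \<in> P" using Cons.prems by auto
  have "map_pmf fst (paging_run (q # r)) =
      bind_pmf (map_pmf fst (paging_run r)) (\<lambda>B. map_pmf ((\<inter>) (insert q B)) (random_subset P ?\<rho>))"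
    by (simp add: map_bind_pmf bind_map_pmf map_pmf_comp kernel_def)
  also have "\<dots> = bind_pmf (map_pmf (insert q) (random_subset P (keep_prob r))) (\<lambda>B. map_pmf ((\<inter>) B) (random_subset P ?\<rho>))"
    using Cons by (simp add: bind_map_pmf)
  also have "\<dots> = bind_pmf (random_subset P ((keep_prob r)(q := 1))) (\<lambda>B. map_pmf ((\<inter>) B) (random_subset P ?\<rho>))"
    using finite_pages r by (simp add: random_subset_insert_elem)
  also have "\<dots> = random_subset P (\<lambda>p. ((keep_prob r)(q := 1)) p * ?\<rho> p)"
  proof (rule random_subset_inter[OF finite_pages])
    fix p assume "p \<in> P"
    show "0 \<le> ((keep_prob r)(q := 1)) p \<and> ((keep_prob r)(q := 1)) p \<le> 1"
      using keep_prob_bounds[OF r(1) \<open>p \<in> P\<close>] by auto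
    show "0 \<le> ?\<rho> p \<and> ?\<rho> p \<le> 1"
      using keep_prob_factor(2,3)[OF r \<open>p \<in> P\<close>] by (simp add: power_le_one)
  qed
  also have "\<dots> = random_subset P (keep_prob (q # r))"
    using keep_prob_factor(1)[OF r] by (intro random_subset_cong) auto
  finally show ?case .
qed

text \<open>Invariant of the algorithm. By the last clause, as long as the state stays infeasible
  without a new page entering it, an overflow evicts only pages that have just become heavy.\<close>

definition good_state :: "'p list \<Rightarrow> 'p set \<Rightarrow> 'p set \<Rightarrow> bool" where
  "good_state r B C \<longleftrightarrow> B \<subseteq> P \<and> C \<subseteq> B \<and> C \<subseteq> set r \<and> f C \<le> k \<and> (k < f B \<longrightarrow> (\<forall>p\<in>C. frac r p < tau))"

text \<open>The new cache is feasible either as a subset of a feasible state or as a set of light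
  pages, by \<open>light_feasible\<close>. The requested page survives as its factor is 1 and its
  fractional value 0.\<close>

lemma kernel_step:
  assumes r: "set r \<subseteq> P" "q \<in> P" and g: "good_state r B (last ({} # Ts))"
    and w: "(B', T) \<in> set_pmf (kernel r B Ts q)"
  shows "good_state (q # r) B' T" "legal_step f k (last ({} # Ts)) q T"
    "B' \<subseteq> insert q B" "q \<in> B'" "T = next_cache (q # r) B' (insert q (last ({} # Ts)))"
    and "insert q (last ({} # Ts)) \<inter> B' = T \<or> k < f B'"
proof -
  let ?C = "last ({} # Ts)" and ?\<rho> = "\<lambda>p. ((1 - frac (q # r) p) / (1 - ((frac r)(q := 0)) p)) ^ n"
  obtain K where K: "K \<in> set_pmf (random_subset P ?\<rho>)" "B' = insert q B \<inter> K"
    "T = next_cache (q # r) B' (insert q ?C)"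
    using w by (auto simp: kernel_def)
  have KP: "K \<subseteq> P" using K(1) by (rule set_random_subset)
  have y: "frac (q # r) q = 0" using r by (rule frac_requested)
  have "q \<in> K"
    by (rule random_subset_prob_one[OF finite_pages K(1) r(2)]) (simp add: y)
  then show B': "B' \<subseteq> insert q B" "q \<in> B'" using K by auto
  show T: "T = next_cache (q # r) B' (insert q ?C)" by (rule K(3))
  then show "insert q ?C \<inter> B' = T \<or> k < f B'" by (auto simp: next_cache_def)
  have light: "f {p \<in> P. frac (q # r) p < tau} \<le> k"
    using frac_covers[OF r] by (rule light_feasible)
  have fT: "f T \<le> k"
  proof (cases "k < f B'")
    case True
    then have "T \<subseteq> {p \<in> P. frac (q # r) p < tau}" by (auto simp: T next_cache_def)
    then have "f T \<le> f {p \<in> P. frac (q # r) p < tau}" by (intro f_mono) auto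
    then show ?thesis using light by simp
  next
    case False
    have "T \<subseteq> B'" using False by (auto simp: T next_cache_def)
    then have "f T \<le> f B'" using K KP by (intro f_mono) auto
    then show ?thesis using False by simp
  qed
  have qT: "q \<in> T" using B'(2) r(2) y tau_pos by (auto simp: T next_cache_def)
  have sub: "T \<subseteq> insert q ?C" "T \<subseteq> B'" by (auto simp: T next_cache_def split: if_splits)
  show "legal_step f k ?C q T" using qT sub fT by (simp add: legal_step_def)
  have "\<forall>p\<in>T. frac (q # r) p < tau" if "k < f B'" using that by (auto simp: T next_cache_def)
  then show "good_state (q # r) B' T"
    using g sub fT K(2) KP by (auto simp: good_state_def)
qed

lemma paging_run_invariant:
  "set r \<subseteq> P \<Longrightarrow> (B, Ts) \<in> set_pmf (paging_run r) \<Longrightarrow>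
     good_state r B (last ({} # Ts)) \<and> schedule f k {} (rev r) Ts"
proof (induction r arbitrary: B Ts)
  case Nil
  then show ?case using empty_feasible by (simp add: good_state_def)
next
  case (Cons q r)
  then obtain B0 Us T where *: "(B0, Us) \<in> set_pmf (paging_run r)" "(B, T) \<in> set_pmf (kernel r B0 Us q)" "Ts = Us @ [T]"
    by auto
  have r: "set r \<subseteq> P" "q \<in> P" using Cons.prems by auto
  have IH: "good_state r B0 (last ({} # Us))" "schedule f k {} (rev r) Us"
    using Cons.IH[OF r(1) *(1)] by auto
  show ?case
    using kernel_step(1,2)[OF r IH(1) *(2)] IH(2) *(3) by (auto simp: schedule_snoc)
qed

lemma online_forget_kernel: "online_algorithm P f k (forget_state kernel {})"
  unfolding online_algorithm_def
proof (intro allI impI ballI)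
  fix ps Ts p T
  assume ps: "set ps \<subseteq> P" and p: "p \<in> P" and T: "T \<in> set_pmf (forget_state kernel {} ps Ts p)"
  have r: "set (rev ps) \<subseteq> P" using ps by simp
  from set_forget_state[OF T] show "legal_step f k (last ({} # Ts)) p T"
  proof (elim disjE exE conjE)
    assume "T = {p}"
    then show ?thesis using p singleton_feasible by (simp add: legal_step_def)
  next
    fix B B' assume *: "(B, Ts) \<in> set_pmf (paging_run (rev ps))" "(B', T) \<in> set_pmf (kernel (rev ps) B Ts p)"
    show ?thesis
      using kernel_step(2)[OF r p _ *(2)] paging_run_invariant[OF r *(1)] by blast
  qed
qed

lemma cost_bounds: "p \<in> P \<Longrightarrow> c_min P c \<le> c p" "p \<in> P \<Longrightarrow> c p \<le> c_max P c"
  using finite_pages by (auto simp: c_min_def c_max_def)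

lemma c_min_pos: "0 < c_min P c"
  unfolding c_min_def using finite_pages nonempty cost_pos by (subst Min_gr_iff) auto

lemma sum_cost_le:
  assumes "C \<subseteq> P" "f C \<le> k" "D \<subseteq> C"
  shows "(\<Sum>p\<in>D. c p) \<le> real mu * c_max P c"
proof -
  have fin: "finite C" using assms(1) finite_pages by (rule finite_subset)
  have "card D \<le> card C" using fin assms(3) by (rule card_mono)
  then have cD: "card D \<le> mu" using card_le_mu[OF assms(1,2)] by simp
  obtain p where "p \<in> P" using nonempty by auto
  then have cm: "0 \<le> c_max P c" using cost_bounds(2)[of p] cost_pos[of p] by linarith
  have "(\<Sum>p\<in>D. c p) \<le> real (card D) * c_max P c"
    using assms by (intro sum_bounded_above cost_bounds(2)) auto
  also have "\<dots> \<le> real mu * c_max P c" using cD cm by (intro mult_right_mono) auto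
  finally show ?thesis .
qed

end

section \<open>Expected cost of the rounding\<close>

context paging_rounding
begin

definition eps :: real where "eps = real (f P) / 2 ^ n"

lemma eps_nonneg: "0 \<le> eps"
  by (simp add: eps_def)

text \<open>
  The three summands account for evictions because a page leaves the private state, for evictions
  because a page becomes heavy while the private state is infeasible, and for evictions at the
  time the private state becomes infeasible.
\<close>

lemma step_cost_le:
  assumes r: "set r \<subseteq> P" "q \<in> P" and g: "good_state r B (last ({} # Ts))"
    and w: "(B', T) \<in> set_pmf (kernel r B Ts q)"
    and W: "\<And>C. C \<subseteq> set r \<Longrightarrow> f C \<le> k \<Longrightarrow> (\<Sum>p | p \<in> C \<and> p \<noteq> q \<and> tau \<le> frac (q # r) p. c p) \<le> W"
  shows "(\<Sum>p\<in>last ({} # Ts) - T. c p) \<le>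
      (\<Sum>p\<in>P - {q}. c p * (of_bool (p \<in> B) - of_bool (p \<in> B'))) +
      of_bool (k < f B') * (\<Sum>p\<in>P - {q}. c p * (of_bool (tau \<le> frac (q # r) p) - of_bool (tau \<le> frac r p))) +
      of_bool (q \<notin> B) * of_bool (k < f B') * W"
proof -
  let ?C = "last ({} # Ts)" and ?y = "frac (q # r)" and ?x = "frac r"
  note BP = g[unfolded good_state_def, THEN conjunct1]
    and CB = g[unfolded good_state_def, THEN conjunct2, THEN conjunct1]
    and Cr = g[unfolded good_state_def, THEN conjunct2, THEN conjunct2, THEN conjunct1]
    and fC = g[unfolded good_state_def, THEN conjunct2, THEN conjunct2, THEN conjunct2, THEN conjunct1]
    and light = g[unfolded good_state_def, THEN conjunct2, THEN conjunct2, THEN conjunct2, THEN conjunct2]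
  note CP = CB BP
  note step = kernel_step[OF r g w]
  have finC: "finite ?C" using order_trans[OF CP] finite_pages by (rule finite_subset)
  have B'sub: "p \<in> B" if "p \<in> B'" "p \<noteq> q" for p using step(3) that by auto
  have nn: "0 \<le> c p" if "p \<in> P" for p using cost_pos[OF that] by simp
  have t1: "0 \<le> c p * (of_bool (p \<in> B) - of_bool (p \<in> B'))" if "p \<in> P - {q}" for p
    using nn[of p] that B'sub[of p] by auto
  have cross: "0 \<le> c p * (of_bool (tau \<le> ?y p) - of_bool (tau \<le> ?x p))" if "p \<in> P - {q}" for p
    using nn[of p] that frac_mono[of r q p] r by auto
  have qC: "q \<notin> ?C - T" using step(2) by (auto simp: legal_step_def)
  have "(\<Sum>p\<in>?C - T - B'. c p) = (\<Sum>p\<in>?C - T - B'. c p * (of_bool (p \<in> B) - of_bool (p \<in> B')))"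
    using CP by (intro sum.cong) auto
  also have "\<dots> \<le> (\<Sum>p\<in>P - {q}. c p * (of_bool (p \<in> B) - of_bool (p \<in> B')))"
    using finite_pages CP t1 qC by (intro sum_mono2) auto
  finally have 1: "(\<Sum>p\<in>?C - T - B'. c p) \<le> (\<Sum>p\<in>P - {q}. c p * (of_bool (p \<in> B) - of_bool (p \<in> B')))" .
  \<comment> \<open>A cached page that stays in the state is evicted only in an overflow, and then
    it is heavy.\<close>
  define H where "H = {p. p \<in> ?C \<and> p \<noteq> q \<and> tau \<le> ?y p}"
  have 2: "(\<Sum>p\<in>(?C - T) \<inter> B'. c p) \<le> of_bool (k < f B') * (\<Sum>p\<in>H. c p)"
  proof (cases "k < f B'")
    case True
    have "(?C - T) \<inter> B' \<subseteq> H"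
      using True qC CP unfolding H_def step(5) next_cache_def by auto
    then have "(\<Sum>p\<in>(?C - T) \<inter> B'. c p) \<le> (\<Sum>p\<in>H. c p)"
      using finC CP nn by (intro sum_mono2) (auto simp: H_def)
    then show ?thesis using True by simp
  next
    case False
    then have "(?C - T) \<inter> B' = {}" using step(6) by auto
    then show ?thesis using False by simp
  qed
  have 3: "of_bool (k < f B') * (\<Sum>p\<in>H. c p) \<le>
      of_bool (k < f B') * (\<Sum>p\<in>P - {q}. c p * (of_bool (tau \<le> ?y p) - of_bool (tau \<le> ?x p))) +
      of_bool (q \<notin> B) * of_bool (k < f B') * W" (is "_ \<le> of_bool _ * ?V + _")
  proof (cases "k < f B'")
    case True
    have V: "0 \<le> ?V" using cross by (rule sum_nonneg)
    show ?thesis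
    proof (cases "q \<in> B")
      case False
      have "(\<Sum>p\<in>H. c p) \<le> W" unfolding H_def using Cr fC by (rule W)
      then show ?thesis using False True V by simp
    next
      \<comment> \<open>With \<open>q\<close> already in the state nothing was added, so the old
        state was infeasible and the cache light; each page of \<open>H\<close> crossed
        \<open>tau\<close> in this very step.\<close>
      case qB: True
      have "f B' \<le> f B" using step(3) qB CP by (intro f_mono) auto
      then have "k < f B" using True by simp
      then have light': "?x p < tau" if "p \<in> ?C" for p using light that by blast
      have "(\<Sum>p\<in>H. c p) = (\<Sum>p\<in>H. c p * (of_bool (tau \<le> ?y p) - of_bool (tau \<le> ?x p)))"
        using light' by (intro sum.cong) (auto simp: H_def not_le)
      also have "\<dots> \<le> ?V"
        using finite_pages CP cross by (intro sum_mono2) (auto simp: H_def)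
      finally show ?thesis using True qB by simp
    qed
  qed simp
  have "(\<Sum>p\<in>?C - T. c p) = (\<Sum>p\<in>(?C - T) \<inter> B'. c p) + (\<Sum>p\<in>?C - T - B'. c p)"
    using finC by (subst sum.Int_Diff[of _ _ B']) auto
  then show ?thesis using 1 2 3 by linarith
qed

text \<open>Average of \<open>step_cost_le\<close>. The law of the state gives the first sum and
  \<open>infeasible_prob\<close> the second. For the third, \<open>q \<notin> B\<close> is
  independent of the infeasibility of the new state, which depends on \<open>B\<close> only through
  \<open>insert q B\<close>.\<close>

lemma expected_step_cost_le:
  fixes W :: real
  assumes r: "set r \<subseteq> P" "q \<in> P" and W0: "0 \<le> W"
    and W: "\<And>C. C \<subseteq> set r \<Longrightarrow> f C \<le> k \<Longrightarrow> (\<Sum>p | p \<in> C \<and> p \<noteq> q \<and> tau \<le> frac (q # r) p. c p) \<le> W"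
  shows "measure_pmf.expectation (paging_run (q # r)) (\<lambda>z. eviction_cost c {} (snd z)) \<le>
      measure_pmf.expectation (paging_run r) (\<lambda>z. eviction_cost c {} (snd z)) +
      (\<Sum>p\<in>P - {q}. c p * (keep_prob r p - keep_prob (q # r) p)) +
      eps * (\<Sum>p\<in>P - {q}. c p * (of_bool (tau \<le> frac (q # r) p) - of_bool (tau \<le> frac r p))) +
      (1 - keep_prob r q) * eps * W"
proof -
  define J where "J = paging_run r"
  define N where "N = (\<lambda>z. kernel r (fst z) (snd z) q)"
  define V where "V = (\<Sum>p\<in>P - {q}. c p * (of_bool (tau \<le> frac (q # r) p) - of_bool (tau \<le> frac r p)))"
  let ?E = "\<lambda>M h. measure_pmf.expectation M (h :: _ \<Rightarrow> real)"
  let ?bad = "\<lambda>w. of_bool (k < f (fst w)) :: real"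
  have finJ: "finite (set_pmf J)" and finN: "finite (set_pmf (N z))" for z
    unfolding J_def N_def by (rule finite_paging_run, rule finite_kernel)
  have intJ: "integrable J h" and intN: "integrable (N z) h'" for h :: "_ \<Rightarrow> real" and h' :: "_ \<Rightarrow> real" and z
    by (rule integrable_measure_pmf_finite[OF finJ], rule integrable_measure_pmf_finite[OF finN])
  have rq: "set (q # r) \<subseteq> P" using r by simp
  have run_Cons: "paging_run (q # r) = bind_pmf J (\<lambda>z. map_pmf (\<lambda>w. (fst w, snd z @ [snd w])) (N z))"
    by (simp add: J_def N_def)
  have E_Cons: "?E (paging_run (q # r)) h = ?E J (\<lambda>z. ?E (N z) (\<lambda>w. h (fst w, snd z @ [snd w])))" for h
    unfolding run_Cons using finJ finN by (subst expectation_bind_finite) auto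
  have E_fst: "?E J (\<lambda>z. h (fst z)) = ?E (random_subset P (keep_prob r)) h" for h
    unfolding J_def state_distribution[OF r(1), symmetric] by simp
  have E_fst_Cons: "?E J (\<lambda>z. ?E (N z) (\<lambda>w. h (fst w))) = ?E (random_subset P (keep_prob (q # r))) h" for h
    unfolding state_distribution[OF rq, symmetric] by (simp add: E_Cons del: state_run.simps)
  have bad: "?E (random_subset P (keep_prob (q # r))) (\<lambda>R. of_bool (k < f R)) \<le> eps"
    unfolding keep_prob_def[abs_def] eps_def
    using frac_bounds[OF rq] frac_covers[OF r] by (intro infeasible_prob) auto
  have E_keep: "?E J (\<lambda>z. of_bool (p \<in> fst z)) = keep_prob r p"
    "?E J (\<lambda>z. ?E (N z) (\<lambda>w. of_bool (p \<in> fst w))) = keep_prob (q # r) p" if "p \<in> P" for p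
    using that finite_pages keep_prob_bounds[OF r(1) that] keep_prob_bounds[OF rq that]
    by (simp_all add: E_fst[of "\<lambda>R. of_bool (p \<in> R)"] E_fst_Cons[of "\<lambda>R. of_bool (p \<in> R)"] expectation_random_subset_mem)
  have E_new: "?E J (\<lambda>z. of_bool (q \<notin> fst z) * ?E (N z) ?bad) \<le> (1 - keep_prob r q) * eps"
  proof -
    define G where "G = (\<lambda>S. ?E (random_subset P (\<lambda>p. ((1 - frac (q # r) p) / (1 - ((frac r)(q := 0)) p)) ^ n))
        (\<lambda>K. of_bool (k < f (S \<inter> K))))"
    have G: "?E (N z) ?bad = G (insert q (fst z))" for z
      by (simp add: N_def kernel_def G_def)
    have "?E J (\<lambda>z. of_bool (q \<notin> fst z) * ?E (N z) ?bad) =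
        ?E (random_subset P (keep_prob r)) (\<lambda>R. of_bool (q \<notin> R) * G (insert q R))"
      unfolding G by (rule E_fst)
    also have "\<dots> = (1 - keep_prob r q) * ?E (random_subset P (keep_prob r)) (\<lambda>R. G (insert q R))"
      using keep_prob_bounds[OF r] by (intro expectation_random_subset_indep finite_pages r(2)) auto
    also have "?E (random_subset P (keep_prob r)) (\<lambda>R. G (insert q R)) = ?E J (\<lambda>z. ?E (N z) ?bad)"
      unfolding G by (rule E_fst[symmetric])
    also have "\<dots> = ?E (random_subset P (keep_prob (q # r))) (\<lambda>R. of_bool (k < f R))"
      by (rule E_fst_Cons)
    also have "(1 - keep_prob r q) * \<dots> \<le> (1 - keep_prob r q) * eps"
      using bad keep_prob_bounds[OF r] by (intro mult_left_mono) auto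
    finally show ?thesis .
  qed
  have V0: "0 \<le> V"
    unfolding V_def using r frac_mono[of r q] cost_pos by (intro sum_nonneg) (force simp: less_imp_le)
  have "?E (paging_run (q # r)) (\<lambda>z. eviction_cost c {} (snd z)) =
      ?E J (\<lambda>z. ?E (N z) (\<lambda>w. eviction_cost c {} (snd z) + (\<Sum>p\<in>last ({} # snd z) - snd w. c p)))"
    by (simp add: E_Cons eviction_cost_snoc del: state_run.simps last.simps)
  also have "\<dots> \<le> ?E J (\<lambda>z. ?E (N z) (\<lambda>w. eviction_cost c {} (snd z) +
      ((\<Sum>p\<in>P - {q}. c p * (of_bool (p \<in> fst z) - of_bool (p \<in> fst w))) + ?bad w * V +
       of_bool (q \<notin> fst z) * ?bad w * W)))"
  proof (intro expectation_mono_finite finJ finN add_left_mono)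
    fix z w assume z: "z \<in> set_pmf J" and w: "w \<in> set_pmf (N z)"
    have "good_state r (fst z) (last ({} # snd z))"
      using paging_run_invariant[OF r(1), of "fst z" "snd z"] z by (simp add: J_def)
    from step_cost_le[OF r this _ W, of "fst w" "snd w"] w
    show "(\<Sum>p\<in>last ({} # snd z) - snd w. c p) \<le>
      (\<Sum>p\<in>P - {q}. c p * (of_bool (p \<in> fst z) - of_bool (p \<in> fst w))) + ?bad w * V +
       of_bool (q \<notin> fst z) * ?bad w * W"
      by (simp add: N_def V_def)
  qed
  also have "\<dots> = ?E J (\<lambda>z. eviction_cost c {} (snd z) +
      ((\<Sum>p\<in>P - {q}. c p * (of_bool (p \<in> fst z) - ?E (N z) (\<lambda>w. of_bool (p \<in> fst w)))) + ?E (N z) ?bad * V +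
       of_bool (q \<notin> fst z) * ?E (N z) ?bad * W))"
    by (simp add: intN)
  also have "\<dots> = ?E J (\<lambda>z. eviction_cost c {} (snd z)) +
      ((\<Sum>p\<in>P - {q}. c p * (?E J (\<lambda>z. of_bool (p \<in> fst z)) - ?E J (\<lambda>z. ?E (N z) (\<lambda>w. of_bool (p \<in> fst w))))) +
       ?E J (\<lambda>z. ?E (N z) ?bad) * V + ?E J (\<lambda>z. of_bool (q \<notin> fst z) * ?E (N z) ?bad) * W)"
    by (simp add: intJ)
  also have "\<dots> \<le> ?E J (\<lambda>z. eviction_cost c {} (snd z)) +
      ((\<Sum>p\<in>P - {q}. c p * (keep_prob r p - keep_prob (q # r) p)) + eps * V + (1 - keep_prob r q) * eps * W)"
    using bad E_fst_Cons[of "\<lambda>R. of_bool (k < f R)"] E_new E_keep V0 W0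
    by (intro add_mono mult_right_mono) auto
  finally show ?thesis by (simp add: J_def V_def add.assoc)
qed

text \<open>Share of the cost of a page charged at fractional value \<open>t\<close>: the
  probability of being outside the state, plus \<open>eps\<close> once the page is heavy. Its
  increments are the first two sums in \<open>expected_step_cost_le\<close>.\<close>

definition charge :: "real \<Rightarrow> real" where
  "charge t = 1 - (1 - t) ^ n + eps * of_bool (tau \<le> t)"

lemma charge_le:
  assumes "0 \<le> t" "t \<le> 1"
  shows "charge t \<le> (real n + eps * (real mu + 1)) * t"
proof -
  have "1 + real n * (- t) \<le> (1 + (- t)) ^ n" using assms by (intro Bernoulli_inequality) auto
  moreover have "of_bool (tau \<le> t) \<le> (real mu + 1) * t"
    using assms by (auto simp: tau_def field_simps)
  then have "eps * of_bool (tau \<le> t) \<le> eps * ((real mu + 1) * t)"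
    using eps_nonneg by (intro mult_left_mono) auto
  ultimately show ?thesis by (simp add: charge_def algebra_simps)
qed

definition ratio :: real where "ratio = c_max P c / c_min P c"

lemma ratio_ge_1: "1 \<le> ratio"
proof -
  obtain p where "p \<in> P" using nonempty by auto
  then have "c_min P c \<le> c_max P c" using cost_bounds[of p] by simp
  then show ?thesis using c_min_pos by (simp add: ratio_def)
qed

text \<open>Amortisation: the charge of a page stays open until its next request and then moves to
  \<open>paid\<close>. Overflows at a repeated request are charged to the paid fraction of
  \<open>q\<close>; those at a first request, one per page, to the whole fractional cost, hence the
  factor \<open>card (set r)\<close>.\<close>

lemma expected_cost_charged:
  assumes "set r \<subseteq> P"
  shows "measure_pmf.expectation (paging_run r) (\<lambda>z. eviction_cost c {} (snd z)) \<le>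
    (real n + eps * (real mu + 1) + eps * real n * real mu * ratio) * paid r +
    (\<Sum>p\<in>set r. c p * charge (frac r p)) +
    eps * real mu * (real mu + 1) * ratio * real (card (set r)) * frac_cost r"
  using assms
proof (induction r)
  case Nil
  then show ?case by (simp add: frac_cost_def)
next
  case (Cons q r)
  then have r: "set r \<subseteq> P" "q \<in> P" by auto
  define a where "a = real n + eps * (real mu + 1)"
  define b where "b = eps * real n * real mu * ratio"
  define d where "d = eps * real mu * (real mu + 1) * ratio"
  let ?x = "frac r" and ?y = "frac (q # r)"
  define E where "E = (\<lambda>r. measure_pmf.expectation (paging_run r) (\<lambda>z. eviction_cost c {} (snd z)))"
  have IH: "E r \<le> (a + b) * paid r + (\<Sum>p\<in>set r. c p * charge (?x p)) + d * real (card (set r)) * frac_cost r"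
    using Cons.IH[OF r(1)] by (simp add: E_def a_def b_def d_def)
  have nonneg: "0 \<le> a" "0 \<le> b" "0 \<le> d"
    using eps_nonneg ratio_ge_1 by (auto simp: a_def b_def d_def)
  have fc0: "0 \<le> frac_cost r"
    using frac_bounds[OF r(1)] cost_pos r(1) paid_nonneg[OF r(1)] unfolding frac_cost_def
    by (intro add_nonneg_nonneg sum_nonneg mult_nonneg_nonneg) (auto simp: less_imp_le subset_iff)
  have fcm: "frac_cost r \<le> frac_cost (q # r)" using r by (rule frac_cost_mono)
  have split: "(\<Sum>p\<in>P - {q}. c p * (keep_prob r p - keep_prob (q # r) p)) +
      eps * (\<Sum>p\<in>P - {q}. c p * (of_bool (tau \<le> ?y p) - of_bool (tau \<le> ?x p))) =
      (\<Sum>p\<in>set (q # r). c p * charge (?y p)) - (\<Sum>p\<in>set r. c p * charge (?x p)) +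
      (if q \<in> set r then c q * charge (?x q) else 0)"
  proof -
    have "(\<Sum>p\<in>P - {q}. c p * (keep_prob r p - keep_prob (q # r) p)) +
      eps * (\<Sum>p\<in>P - {q}. c p * (of_bool (tau \<le> ?y p) - of_bool (tau \<le> ?x p))) =
      (\<Sum>p\<in>P - {q}. c p * (charge (?y p) - charge (?x p)))"
      unfolding sum_distrib_left sum.distrib[symmetric]
      by (intro sum.cong) (auto simp: charge_def keep_prob_def algebra_simps)
    also have "\<dots> = (\<Sum>p\<in>set r - {q}. c p * (charge (?y p) - charge (?x p)))"
    proof (rule sum.mono_neutral_right)
      show "\<forall>p\<in>P - {q} - (set r - {q}). c p * (charge (?y p) - charge (?x p)) = 0"
      proof
        fix p assume "p \<in> P - {q} - (set r - {q})"
        then have "?y p = 1" "?x p = 1"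
          using frac_unrequested[of "q # r" p] frac_unrequested[of r p] r by auto
        then show "c p * (charge (?y p) - charge (?x p)) = 0" by simp
      qed
    qed (use finite_pages r in auto)
    also have "\<dots> = (\<Sum>p\<in>set r - {q}. c p * charge (?y p)) - (\<Sum>p\<in>set r - {q}. c p * charge (?x p))"
      by (simp add: algebra_simps sum_subtractf)
    also have "(\<Sum>p\<in>set r - {q}. c p * charge (?y p)) = (\<Sum>p\<in>set (q # r). c p * charge (?y p))"
    proof (rule sum.mono_neutral_left)
      show "\<forall>p\<in>set (q # r) - (set r - {q}). c p * charge (?y p) = 0"
        using frac_requested[OF r] tau_pos by (auto simp: charge_def)
    qed auto
    also have "(\<Sum>p\<in>set r - {q}. c p * charge (?x p)) =
        (\<Sum>p\<in>set r. c p * charge (?x p)) - (if q \<in> set r then c q * charge (?x q) else 0)"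
      by (simp add: sum_diff1)
    finally show ?thesis by simp
  qed
  have kq: "0 \<le> 1 - keep_prob r q" "1 - keep_prob r q \<le> 1"
    using keep_prob_bounds[OF r] by auto
  have "E (q # r) \<le> (a + b) * paid (q # r) + (\<Sum>p\<in>set (q # r). c p * charge (?y p)) + d * real (card (set (q # r))) * frac_cost (q # r)"
  proof (cases "q \<in> set r")
    case True
    have xq: "0 \<le> ?x q" "?x q \<le> 1" using frac_bounds[OF r] by auto
    have cm0: "0 \<le> real mu * c_max P c" using sum_cost_le[of "{}" "{}"] empty_feasible by simp
    have "E (q # r) \<le> E r + (\<Sum>p\<in>P - {q}. c p * (keep_prob r p - keep_prob (q # r) p)) +
      eps * (\<Sum>p\<in>P - {q}. c p * (of_bool (tau \<le> ?y p) - of_bool (tau \<le> ?x p))) +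
      (1 - keep_prob r q) * eps * (real mu * c_max P c)"
      unfolding E_def using r(1) by (intro expected_step_cost_le r cm0 sum_cost_le) auto
    \<comment> \<open>The state misses \<open>q\<close> with probability at most \<open>n\<close>
      times its evicted fraction, and \<open>c q\<close> times that fraction is just being
      paid.\<close>
    moreover have "(1 - keep_prob r q) * eps * (real mu * c_max P c) \<le> b * (c q * ?x q)"
    proof -
      have "1 + real n * (- ?x q) \<le> (1 + (- ?x q)) ^ n" using xq by (intro Bernoulli_inequality) auto
      then have "1 - keep_prob r q \<le> real n * ?x q" by (simp add: keep_prob_def)
      then have "(1 - keep_prob r q) * (eps * (real mu * c_max P c)) \<le> real n * ?x q * (eps * (real mu * c_max P c))"
        using eps_nonneg cm0 by (intro mult_right_mono) auto
      also have "\<dots> = b * ?x q * c_min P c"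
        using c_min_pos by (simp add: b_def ratio_def)
      also have "\<dots> \<le> b * ?x q * c q"
        using nonneg xq cost_bounds(1)[OF r(2)] by (intro mult_left_mono) auto
      finally show ?thesis by (simp only: mult_ac)
    qed
    moreover have "c q * charge (?x q) \<le> c q * (a * ?x q)"
      using charge_le[OF xq] cost_pos[OF r(2)] by (intro mult_left_mono) (auto simp: a_def)
    moreover have "d * real (card (set r)) * frac_cost r \<le> d * real (card (set (q # r))) * frac_cost (q # r)"
      using True nonneg fcm by (simp add: insert_absorb mult_left_mono)
    ultimately show ?thesis using IH split True by (simp add: algebra_simps)
  next
    case False
    \<comment> \<open>If some cached page other than \<open>q\<close> is heavy, the fractional cost
      is at least \<open>c_min P c * tau\<close>, so the last factor is at least 1; otherwise the
      sum to be bounded is empty.\<close>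
    define W where "W = real mu * c_max P c * (frac_cost (q # r) / (c_min P c * tau))"
    have cm0: "0 \<le> real mu * c_max P c" using sum_cost_le[of "{}" "{}"] empty_feasible by simp
    have ct: "0 < c_min P c * tau" using c_min_pos tau_pos by simp
    have W0: "0 \<le> W"
      unfolding W_def using ct fc0 fcm by (intro mult_nonneg_nonneg[OF cm0] divide_nonneg_pos) auto
    have "E (q # r) \<le> E r + (\<Sum>p\<in>P - {q}. c p * (keep_prob r p - keep_prob (q # r) p)) +
      eps * (\<Sum>p\<in>P - {q}. c p * (of_bool (tau \<le> ?y p) - of_bool (tau \<le> ?x p))) +
      (1 - keep_prob r q) * eps * W"
      unfolding E_def
    proof (intro expected_step_cost_le r W0)
      fix C assume C: "C \<subseteq> set r" "f C \<le> k"
      let ?H = "{p. p \<in> C \<and> p \<noteq> q \<and> tau \<le> ?y p}"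
      show "(\<Sum>p\<in>?H. c p) \<le> W"
      proof (cases "?H = {}")
        case True
        then show ?thesis using W0 by (simp only: sum.empty)
      next
        case False
        then obtain p where p: "p \<in> set r" "tau \<le> ?y p" using C by auto
        have pP: "p \<in> P" using p r by auto
        have "c_min P c * tau \<le> c p * ?y p"
          using cost_bounds(1)[OF pP] p(2) c_min_pos tau_pos cost_pos[OF pP] by (intro mult_mono) auto
        also have "\<dots> \<le> frac_cost (q # r)" using p r by (intro frac_cost_ge) auto
        finally have "1 \<le> frac_cost (q # r) / (c_min P c * tau)" using ct by simp
        then have "real mu * c_max P c * 1 \<le> W" unfolding W_def using cm0 by (intro mult_left_mono)
        moreover have "(\<Sum>p\<in>?H. c p) \<le> real mu * c_max P c"
          using C r by (intro sum_cost_le[of C]) auto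
        ultimately show ?thesis by simp
      qed
    qed
    moreover have "(1 - keep_prob r q) * eps * W \<le> d * frac_cost (q # r)"
    proof -
      have "(1 - keep_prob r q) * (eps * W) \<le> 1 * (eps * W)"
        using kq eps_nonneg W0 by (intro mult_right_mono) auto
      also have "\<dots> = d * frac_cost (q # r)"
        by (simp add: W_def d_def ratio_def tau_def field_simps)
      finally show ?thesis by (simp add: mult.assoc)
    qed
    moreover have "d * real (card (set r)) * frac_cost r \<le> d * real (card (set r)) * frac_cost (q # r)"
      using nonneg fcm by (intro mult_left_mono) auto
    moreover have "d * real (card (set (q # r))) * frac_cost (q # r) = d * real (card (set r)) * frac_cost (q # r) + d * frac_cost (q # r)"
      using False by (simp add: algebra_simps)
    ultimately show ?thesis using IH split False by simp
  qed
  then show ?case by (simp add: E_def a_def b_def d_def)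
qed

lemma expected_cost_le_frac_cost:
  assumes "set r \<subseteq> P"
  shows "measure_pmf.expectation (paging_run r) (\<lambda>z. eviction_cost c {} (snd z)) \<le>
    (real n + eps * (real mu + 1) + eps * real n * real mu * ratio +
     eps * real mu * (real mu + 1) * ratio * real (card P)) * frac_cost r"
proof -
  define a where "a = real n + eps * (real mu + 1)"
  define b where "b = eps * real n * real mu * ratio"
  define d where "d = eps * real mu * (real mu + 1) * ratio"
  have nonneg: "0 \<le> a" "0 \<le> b" "0 \<le> d"
    using eps_nonneg ratio_ge_1 by (auto simp: a_def b_def d_def)
  define s where "s = (\<Sum>p\<in>set r. c p * frac r p)"
  have x01: "0 \<le> frac r p \<and> frac r p \<le> 1" if "p \<in> set r" for p
    using frac_bounds[OF assms, of p] assms that by auto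
  have cn: "0 \<le> c p" if "p \<in> set r" for p using cost_pos[of p] assms that by auto
  have s0: "0 \<le> s" unfolding s_def using x01 cn by (intro sum_nonneg mult_nonneg_nonneg) auto
  have fc: "frac_cost r = paid r + s" by (simp add: frac_cost_def s_def)
  have p0: "0 \<le> paid r" using assms by (rule paid_nonneg)
  have "(\<Sum>p\<in>set r. c p * charge (frac r p)) \<le> (\<Sum>p\<in>set r. c p * (a * frac r p))"
    using x01 cn charge_le by (intro sum_mono mult_left_mono) (auto simp: a_def)
  also have "\<dots> = a * s" by (simp add: s_def sum_distrib_left mult_ac)
  finally have 1: "(\<Sum>p\<in>set r. c p * charge (frac r p)) \<le> a * s" .
  have "card (set r) \<le> card P" using finite_pages assms by (rule card_mono)
  then have 2: "d * real (card (set r)) * frac_cost r \<le> d * real (card P) * frac_cost r"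
    using nonneg fc s0 p0 by (intro mult_right_mono mult_left_mono) auto
  have 3: "0 \<le> b * s" using nonneg s0 by simp
  have "measure_pmf.expectation (paging_run r) (\<lambda>z. eviction_cost c {} (snd z)) \<le>
      (a + b) * paid r + a * s + d * real (card P) * frac_cost r"
    using expected_cost_charged[OF assms] 1 2 by (simp add: a_def b_def d_def)
  also have "\<dots> \<le> (a + b) * frac_cost r + d * real (card P) * frac_cost r"
    using 3 by (simp add: fc algebra_simps)
  finally show ?thesis by (simp add: a_def b_def d_def algebra_simps)
qed

end

section \<open>The competitive ratio\<close>

lemma exists_schedule:
  assumes "\<And>p. p \<in> set ps \<Longrightarrow> f {p} \<le> k"
  shows "\<exists>Ts. schedule f k S ps Ts"
  using assms
proof (induction ps arbitrary: S)
  case Nil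
  show ?case by (rule exI[of _ "[]"]) simp
next
  case (Cons p ps)
  then obtain Ts where "schedule f k {p} ps Ts" by force
  then have "schedule f k S (p # ps) ({p} # Ts)" using Cons.prems by (simp add: legal_step_def)
  then show ?case by blast
qed

lemma exists_free_schedule:
  assumes "\<And>T. T \<subseteq> S \<union> set ps \<Longrightarrow> f T \<le> k"
  shows "\<exists>Ts. schedule f k S ps Ts \<and> eviction_cost c S Ts = 0"
  using assms
proof (induction ps arbitrary: S)
  case Nil
  show ?case by (rule exI[of _ "[]"]) simp
next
  case (Cons p ps)
  have "f T \<le> k" if "T \<subseteq> insert p S \<union> set ps" for T
    using Cons.prems[of T] that by simp
  then obtain Ts where "schedule f k (insert p S) ps Ts" "eviction_cost c (insert p S) Ts = 0"
    using Cons.IH[of "insert p S"] by blast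
  moreover have "(\<Sum>p\<in>S - insert p S. c p) = 0" by (rule sum.neutral) auto
  ultimately have "schedule f k S (p # ps) (insert p S # Ts) \<and> eviction_cost c S (insert p S # Ts) = 0"
    using Cons.prems[of "insert p S"] by (auto simp: legal_step_def)
  then show ?case by blast
qed

lemma le_opt_cost:
  assumes "0 \<le> \<rho>" "schedule f k {} ps Us" "\<And>Ts. schedule f k {} ps Ts \<Longrightarrow> e \<le> \<rho> * eviction_cost c {} Ts"
  shows "e \<le> \<rho> * opt_cost c f k ps"
proof (cases "\<rho> = 0")
  case True
  then show ?thesis using assms by simp
next
  case False
  then have pos: "0 < \<rho>" using assms(1) by simp
  have "e / \<rho> \<le> opt_cost c f k ps"
    unfolding opt_cost_def using assms pos
    by (intro cINF_greatest) (auto simp: pos_divide_le_eq mult.commute)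
  then show ?thesis using pos by (simp add: pos_divide_le_eq mult.commute)
qed

context nonempty_paging
begin

text \<open>While \<open>A\<close> is infeasible some page has positive gain, and removing it lowers
  \<open>f\<close> by at least 1; a feasible rest has at most \<open>mu\<close> pages. This keeps
  the number of pages out of the competitive ratio.\<close>

lemma card_le_mu_plus:
  assumes "A \<subseteq> P"
  shows "card A \<le> mu + f A"
proof -
  have "finite A" using assms finite_pages by (rule finite_subset)
  then show ?thesis using assms
  proof (induction A rule: finite_psubset_induct)
    case (psubset A)
    show ?case
    proof (cases "f A \<le> k")
      case True
      then show ?thesis using card_le_mu[OF psubset.prems] by simp
    next
      case False
      then have "0 < excess A" by (simp add: excess_pos_iff)
      also have "excess A \<le> (\<Sum>p\<in>A. gain A p)"
        using excess_le_gain_outside[OF psubset.prems, of "{}"] empty_feasible by simp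
      finally obtain p where p: "p \<in> A" "0 < gain A p" by (meson not_le sum_nonpos)
      have "f (A - {p}) < f A"
      proof (rule ccontr)
        assume "\<not> ?thesis"
        then have "f A - k \<le> f (A - {p}) - k" by simp
        then show False using p(2) by (simp add: gain_def excess_def)
      qed
      moreover have "card (A - {p}) \<le> mu + f (A - {p})"
        using p psubset.prems by (intro psubset.IH) auto
      moreover have "card A = Suc (card (A - {p}))" by (rule card.remove[OF psubset.hyps(1) p(1)])
      ultimately show ?thesis by simp
    qed
  qed
qed

end

context paging_rounding
begin

definition rounding_factor :: real where
  "rounding_factor = real n + eps * (real mu + 1) + eps * real n * real mu * ratio +
     eps * real mu * (real mu + 1) * ratio * real (card P)"

lemma rounding_factor_nonneg: "0 \<le> rounding_factor"
  using eps_nonneg ratio_ge_1 by (simp add: rounding_factor_def)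

lemma expected_cost_le:
  assumes "set ps \<subseteq> P" "schedule f k {} ps Ts"
  shows "expected_cost c (forget_state kernel {}) ps \<le>
    rounding_factor * (4 * ln (2 * real mu + 3)) * eviction_cost c {} Ts"
proof -
  have "expected_cost c (forget_state kernel {}) ps =
      measure_pmf.expectation (paging_run (rev ps)) (\<lambda>z. eviction_cost c {} (snd z))"
    by (simp add: expected_cost_def run_forget_state)
  also have "\<dots> \<le> rounding_factor * frac_cost (rev ps)"
    unfolding rounding_factor_def using assms by (intro expected_cost_le_frac_cost) auto
  also have "\<dots> \<le> rounding_factor * (4 * ln (2 * real mu + 3) * eviction_cost c {} Ts)"
    using rounding_factor_nonneg assms by (intro mult_left_mono frac_cost_le_opt) auto
  finally show ?thesis by (simp add: mult.assoc)
qed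

lemma competitive_forget_kernel:
  assumes "rounding_factor * (4 * ln (2 * real mu + 3)) \<le> \<rho>"
  shows "competitive P c f k \<rho> (forget_state kernel {})"
  unfolding competitive_def
proof (intro allI impI)
  fix ps assume ps: "set ps \<subseteq> P"
  then obtain Us where Us: "schedule f k {} ps Us"
    using exists_schedule[of ps f k "{}"] singleton_feasible by blast
  have "expected_cost c (forget_state kernel {}) ps \<le>
      rounding_factor * (4 * ln (2 * real mu + 3)) * opt_cost c f k ps"
    using rounding_factor_nonneg Us expected_cost_le[OF ps] by (intro le_opt_cost) auto
  also have "\<dots> \<le> \<rho> * opt_cost c f k ps"
  proof (intro mult_right_mono assms)
    \<comment> \<open>Costs of schedules are nonnegative because a positive multiple of them
      dominates the fractional cost.\<close>
    have "0 \<le> eviction_cost c {} Ts" if "schedule f k {} ps Ts" for Ts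
    proof -
      have "frac_cost [] \<le> frac_cost (rev ps)" if "set ps \<subseteq> P" for ps
        using that
      proof (induction ps rule: rev_induct)
        case (snoc q ps)
        then show ?case using frac_cost_mono[of "rev ps" q] by simp
      qed simp
      then have "0 \<le> frac_cost (rev ps)" using ps by (force simp: frac_cost_def)
      also have "\<dots> \<le> 4 * ln (2 * real mu + 3) * eviction_cost c {} Ts"
        using that ps by (rule frac_cost_le_opt)
      finally show ?thesis by (simp add: zero_le_mult_iff ln_gt_zero not_le)
    qed
    then show "0 \<le> opt_cost c f k ps"
      using le_opt_cost[of 1, OF _ Us, of 0] by simp
  qed
  finally show "expected_cost c (forget_state kernel {}) ps \<le> \<rho> * opt_cost c f k ps" .
qed

text \<open>Handles \<open>f P = 0\<close>, where the bound vanishes: a schedule without evictions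
  exists, and \<open>expected_cost_le\<close> compares against it.\<close>

lemma competitive_forget_kernel_free:
  assumes "f P \<le> k"
  shows "competitive P c f k 0 (forget_state kernel {})"
  unfolding competitive_def
proof (intro allI impI)
  fix ps assume ps: "set ps \<subseteq> P"
  have "f T \<le> k" if "T \<subseteq> {} \<union> set ps" for T
  proof -
    have "T \<subseteq> P" using that ps by auto
    then have "f T \<le> f P" by (rule f_mono) simp
    then show ?thesis using assms by simp
  qed
  then obtain Ts where "schedule f k {} ps Ts" "eviction_cost c {} Ts = 0"
    using exists_free_schedule[of "{}" ps f k c] by blast
  then show "expected_cost c (forget_state kernel {}) ps \<le> 0 * opt_cost c f k ps"
    using expected_cost_le[OF ps] by fastforce
qed

end

text \<open>
  With \<open>2 ^ n \<ge> ((1 + \<mu>) Y)\<^sup>3\<close> the infeasibility probability is so small that every term of the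
  rounding factor other than \<^term>\<open>n\<close> is at most \<^term>\<open>n\<close>.
\<close>

lemma (in paging_rounding) rounding_factor_le:
  assumes "1 \<le> f P" and n: "((1 + real mu) * (1 + ratio * real (f P))) ^ 3 \<le> 2 ^ n"
  shows "rounding_factor \<le> 4 * real n"
proof -
  define F where "F = real (f P)"
  define M where "M = real mu"
  define Y where "Y = 1 + ratio * F"
  define m where "m = (1 + M) * Y"
  have F: "1 \<le> F" and M: "1 \<le> M" and R: "1 \<le> ratio"
    using assms(1) mu_pos ratio_ge_1 by (auto simp: F_def M_def)
  have RF: "F \<le> ratio * F" using R F by (simp add: mult_le_cancel_right1)
  then have Y: "F \<le> Y" "ratio * F \<le> Y" "1 \<le> Y" unfolding Y_def using F RF by linarith+
  have m: "1 \<le> m" "0 \<le> m"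
    using mult_mono[of 1 "1 + M" 1 Y] M Y by (auto simp: m_def)
  have two: "m ^ 3 \<le> 2 ^ n" using n by (simp add: m_def Y_def F_def M_def)
  have mm: "m \<le> m ^ 3" using m self_le_power[of m 3] by simp
  have E: "eps * t \<le> 1" if "F * t \<le> m ^ 3" for t
  proof -
    have "F * t \<le> 2 ^ n" using that two by linarith
    then show ?thesis by (simp add: eps_def F_def divide_le_eq_1)
  qed
  have "F * (M + 1) \<le> Y * (M + 1)" using Y M by (intro mult_right_mono) auto
  also have "\<dots> = m" by (simp add: m_def mult.commute add.commute)
  finally have 1: "eps * (M + 1) \<le> 1" using mm by (intro E) simp
  have "F * (M * ratio) = M * (ratio * F)" by simp
  also have "\<dots> \<le> (1 + M) * Y" using Y M R F by (intro mult_mono) auto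
  finally have "eps * (M * ratio) \<le> 1" using mm by (intro E) (simp add: m_def)
  then have "real n * (eps * (M * ratio)) \<le> real n * 1" by (intro mult_left_mono) auto
  then have 2: "eps * real n * M * ratio \<le> real n" by (simp add: mult_ac)
  have "real (card P) \<le> M + F"
    using card_le_mu_plus[of P] by (simp add: M_def F_def flip: of_nat_add)
  also have "\<dots> \<le> M * Y + Y" using Y M by (intro add_mono) (auto simp: mult_le_cancel_left1)
  also have "\<dots> = m" by (simp add: m_def algebra_simps)
  finally have cP: "real (card P) \<le> m" .
  \<comment> \<open>This term is a product of three factors of at most \<open>m\<close> each, which
    is why \<open>n\<close> is chosen for the cube.\<close>
  have "F * (M * (M + 1) * ratio * real (card P)) = (M * (ratio * F)) * (M + 1) * real (card P)"
    by simp
  also have "\<dots> \<le> m * m * m"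
  proof (intro mult_mono cP)
    show "M * (ratio * F) \<le> m" unfolding m_def using Y M R F by (intro mult_mono) auto
    have "(1 + M) * 1 \<le> (1 + M) * Y" using Y M by (intro mult_left_mono) auto
    then show "M + 1 \<le> m" by (simp add: m_def)
  qed (use m M R F in auto)
  also have "\<dots> = m ^ 3" by (simp add: power3_eq_cube)
  finally have "eps * (M * (M + 1) * ratio * real (card P)) \<le> 1" by (rule E)
  then have 3: "eps * M * (M + 1) * ratio * real (card P) \<le> 1" by (simp add: mult_ac)
  have "1 \<le> real n" using n_pos by simp
  with 1 2 3 show ?thesis unfolding rounding_factor_def M_def by linarith
qed

text \<open>\<open>n\<close> is \<open>3 * log 2 m\<close> rounded up. As \<open>log 2 m\<close> is
  at least 2, a fourth multiple absorbs the rounding.\<close>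

lemma rounds_exist:
  fixes m :: real
  assumes "4 \<le> m"
  obtains n :: nat where "0 < n" "m ^ 3 \<le> 2 ^ n" "real n \<le> 4 * (ln m / ln 2)"
proof
  define n where "n = nat \<lceil>3 * log 2 m\<rceil>"
  have "log 2 4 \<le> log 2 m" using assms by simp
  moreover have "log 2 (4::real) = 2" using log_pow_cancel[of "2::real" 2] by simp
  ultimately have l: "2 \<le> log 2 m" by simp
  have n: "3 * log 2 m \<le> real n" "real n \<le> 3 * log 2 m + 1"
    unfolding n_def using l by linarith+
  show "0 < n" using n l by linarith
  have "m ^ 3 = (2 powr log 2 m) ^ 3" using assms by simp
  also have "\<dots> = 2 powr (3 * log 2 m)" by (simp add: powr_powr mult.commute flip: powr_numeral)
  also have "\<dots> \<le> 2 powr real n" using n by (intro powr_mono) auto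
  finally show "m ^ 3 \<le> 2 ^ n" by (simp add: powr_realpow)
  show "real n \<le> 4 * (ln m / ln 2)" using n l by (simp add: log_def)
qed

text \<open>The number of rounds is governed by a sum of two logarithms, the bound by their product;
  the exchange is possible because both are at least \<open>ln 2\<close>.\<close>

lemma ln_add_le_product:
  fixes u v :: real
  assumes "ln 2 \<le> u" "ln 2 \<le> v"
  shows "u + v \<le> 2 * (u * v) / ln 2"
proof -
  have l: "0 < ln (2::real)" by simp
  have "0 \<le> u" "0 \<le> v" using assms l by linarith+
  then have "u * ln 2 \<le> u * v" "ln 2 * v \<le> u * v"
    using assms by (auto intro: mult_left_mono mult_right_mono)
  then have "(u + v) * ln 2 \<le> 2 * (u * v)" by (simp add: algebra_simps)
  then show ?thesis using l by (simp add: pos_le_divide_eq)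
qed

theorem theorem1p6:
  "\<exists>C>0. \<forall>(P :: 'p set) c f k. supermodular_paging P c f k \<longrightarrow>
     (\<exists>A. online_algorithm P f k A \<and> competitive P c f k (C * competitive_bound P c f k) A)"
proof -
  \<comment> \<open>The factor 32 comes from the estimate of \<open>rounding_factor\<close>, and 12
    from that of \<open>4 * ln (2 * real mu + 3)\<close>.\<close>
  define C :: real where "C = 384 / (ln 2)\<^sup>2"
  have "\<exists>A. online_algorithm P f k A \<and> competitive P c f k (C * competitive_bound P c f k) A"
    if super: "supermodular_paging P c f k" for P :: "'p set" and c f k
  proof (cases "P = {}")
    case True
    have "opt_cost c f k [] = 0"
    proof -
      have "{Ts. schedule f k {} [] Ts} = {[]}"
        by (auto elim: schedule.elims)
      then show ?thesis by (simp add: opt_cost_def)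
    qed
    then show ?thesis using True
      by (auto simp: online_algorithm_def competitive_def expected_cost_def)
  next
    case False
    interpret supermodular_paging P c f k by (rule super)
    interpret nonempty_paging P c f k by unfold_locales (rule False)
    define R where "R = c_max P c / c_min P c"
    show ?thesis
    proof (cases "f P = 0")
      case True
      interpret paging_rounding P c f k 1 by unfold_locales simp
      have "competitive P c f k (C * competitive_bound P c f k) (forget_state kernel {})"
        using competitive_forget_kernel_free True by (simp add: competitive_bound_def)
      then show ?thesis using online_forget_kernel by blast
    next
      case fP: False
      \<comment> \<open>Provides \<open>ratio_ge_1\<close> before the actual \<open>n\<close>, which
        depends on the ratio, is chosen.\<close>
      interpret one: paging_rounding P c f k 1 by unfold_locales simp
      have "1 \<le> R" using one.ratio_ge_1 by (simp add: one.ratio_def R_def)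
      then have RF: "1 \<le> R * real (f P)"
        using fP mult_mono[of 1 R 1 "real (f P)"] by simp
      define Y where "Y = 1 + R * real (f P)"
      have Y: "2 \<le> Y" using RF by (simp add: Y_def)
      have M: "2 \<le> 1 + real mu" using mu_pos by simp
      have m4: "4 \<le> (1 + real mu) * Y" using mult_mono[OF M Y] by simp
      obtain n where n: "0 < n" "((1 + real mu) * Y) ^ 3 \<le> 2 ^ n"
        "real n \<le> 4 * (ln ((1 + real mu) * Y) / ln 2)"
        using rounds_exist[OF m4] by blast
      interpret paging_rounding P c f k n by unfold_locales (rule n(1))
      define u where "u = ln (1 + real mu)"
      define v where "v = ln Y"
      have uv: "ln 2 \<le> u" "ln 2 \<le> v" using M Y by (auto simp: u_def v_def)
      have l2: "0 < ln (2::real)" by simp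
      have "rounding_factor \<le> 4 * real n"
        using fP n(2) by (intro rounding_factor_le) (auto simp: ratio_def R_def Y_def)
      also have "\<dots> \<le> 16 * ((u + v) / ln 2)"
      proof -
        have "ln ((1 + real mu) * Y) = u + v"
          unfolding u_def v_def using M Y by (intro ln_mult_pos) auto
        then have "real n \<le> 4 * ((u + v) / ln 2)" using n(3) by (simp only:)
        then have "4 * real n \<le> 4 * (4 * ((u + v) / ln 2))" by (intro mult_left_mono) auto
        then show ?thesis by simp
      qed
      also have "\<dots> \<le> 16 * ((2 * (u * v) / ln 2) / ln 2)"
        using ln_add_le_product[OF uv] l2 by (intro mult_left_mono divide_right_mono) auto
      finally have rf: "rounding_factor \<le> 32 * (u * v) / (ln 2)\<^sup>2"
        by (simp add: power2_eq_square)
      \<comment> \<open>Makes \<open>ln (2 * real mu + 3)\<close> comparable with \<open>u\<close>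
        at the price of a factor 3.\<close>
      have "2 * real mu + 3 \<le> (1 + real mu) ^ 3"
      proof -
        have "1 \<le> real mu" using mu_pos by simp
        then have "0 \<le> real mu * real mu * real mu" "real mu \<le> real mu * real mu"
          by (auto simp: mult_le_cancel_left1)
        moreover have "(1 + real mu) ^ 3 = 1 + 3 * real mu + 3 * (real mu * real mu) + real mu * real mu * real mu"
          by (simp add: power3_eq_cube algebra_simps)
        ultimately show ?thesis using \<open>1 \<le> real mu\<close> by linarith
      qed
      then have "ln (2 * real mu + 3) \<le> ln ((1 + real mu) ^ 3)" by (intro ln_mono) auto
      also have "\<dots> = 3 * u" by (simp add: u_def ln_realpow)
      finally have ln_le: "4 * ln (2 * real mu + 3) \<le> 12 * u" by simp
      have "0 \<le> u" "0 \<le> v" using uv l2 by linarith+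
      then have "0 \<le> 32 * (u * v) / (ln 2)\<^sup>2" by (intro divide_nonneg_nonneg mult_nonneg_nonneg) auto
      with rf ln_le have "rounding_factor * (4 * ln (2 * real mu + 3)) \<le> 32 * (u * v) / (ln 2)\<^sup>2 * (12 * u)"
        by (rule mult_mono) simp
      also have "\<dots> = C * (u\<^sup>2 * v)" by (simp add: C_def power2_eq_square)
      also have "u\<^sup>2 * v = competitive_bound P c f k"
        by (simp add: competitive_bound_def u_def v_def Y_def R_def)
      finally have "competitive P c f k (C * competitive_bound P c f k) (forget_state kernel {})"
        by (rule competitive_forget_kernel)
      then show ?thesis using online_forget_kernel by blast
    qed
  qed
  moreover have "0 < C" by (simp add: C_def)
  ultimately show ?thesis by blast
qed

end
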